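(* Let $X,Y$ be Banach spaces, let $L:X\to Y$ be a bounded linear operator, let $M:Y\rightrightarrows Y^*$ be maximal monotone, and let $T:=L^*ML:X\rightrightarrows X^*$. ($\alpha$) If $D(T)$ is nonempty, closed and convex, and $N_{D(T)}=L^*N_{D(M)}L$, then $T$ is of NI type. ($\beta$) If $D(M)$ is closed and convex and $0\in{}^{\rm ic}(R(L)-D(M))$, then $T$ is maximal monotone. ($\gamma$) If $D(T)$ is closed and $R(L)\cap\operatorname{int}D(M)\neq\emptyset$, then $T$ is maximal monotone.
   Context: All Banach spaces are real; $X$ is a possibly non-reflexive Banach space with dual $X^*$ (similarly $Y$). A multi-valued operator $A:X\rightrightarrows X^*$ is identified with its graph $A\subset Z:=X\times X^*$; its domain is $D(A)=\{x: Ax\neq\emptyset\}$. Write $p(x,x^* )=\langle x,x^*\rangle=x^*(x)$. $A$ is monotone if $p(a_1-a_2)\ge 0$ for all $a_1,a_2\in A$, and maximal monotone if it is monotone and maximal under inclusion among monotone subsets of $X\times X^*$. For $z=(x,x^* )$, $w=(y,y^* )$ in $Z$ put $z\cdot w=x^*(y)+y^*(x)$. The Fitzpatrick function of a nonempty $A\subset Z$ is $h_A(z)=\sup_{a\in A}\{z\cdot a-p(a)\}$, $z\in Z$. A nonempty $A$ is of NI type if $h_A(z)\ge p(z)$ for every $z\in Z$. $L^*:Y^*\to X^*$ is the adjoint of $L$, $R(L)$ is the range of $L$, and for $S:Y\rightrightarrows Y^*$ the operator $L^*SL:X\rightrightarrows X^*$ is $(L^*SL)(x)=\{L^*y^*: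 y^*\in S(Lx)\}$. For a set $C$ in a Banach space, the normal cone operator $N_C$ is $N_C(x)=\{x^*:\langle y-x,x^*\rangle\le 0\ \forall y\in C\}$ for $x\in C$ and $N_C(x)=\emptyset$ for $x\notin C$. For a subset $S$ of a Banach space, ${}^iS$ denotes its relative algebraic interior, i.e. the algebraic interior (core) of $S$ relative to its affine hull; ${}^{\rm ic}S={}^iS$ if the affine hull of $S$ is closed, and ${}^{\rm ic}S=\emptyset$ otherwise. $\operatorname{int}$ is the norm interior, and closedness of subsets of $X,Y$ is with respect to the norm. *)

theory Defs
  imports "HOL-Analysis.Analysis"
begin

type_synonym 'a dual = "'a \<Rightarrow>\<^sub>L real"

(* A multi-valued operator from 'a to 'b is represented by its graph. *)
type_synonym ('a, 'b) operator = "('a \<times> 'b) set"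

definition values_at :: "('a, 'b) operator \<Rightarrow> 'a \<Rightarrow> 'b set" where
  "values_at A x = {y. (x, y) \<in> A}"

definition dom_op :: "('a, 'b) operator \<Rightarrow> 'a set" where
  "dom_op A = {x. values_at A x \<noteq> {}}"

definition pairing :: "'a::real_normed_vector \<times> 'a dual \<Rightarrow> real" where
  "pairing z = blinfun_apply (snd z) (fst z)"

definition dual_prod ::
    "'a::real_normed_vector \<times> 'a dual \<Rightarrow> 'a \<times> 'a dual \<Rightarrow> real" where
  "dual_prod z w = blinfun_apply (snd z) (fst w) + blinfun_apply (snd w) (fst z)"

definition monotone_op :: "('a::real_normed_vector, 'a dual) operator \<Rightarrow> bool" where
  "monotone_op A \<longleftrightarrow> (\<forall>a1\<in>A. \<forall>a2\<in>A. pairing (a1 - a2) \<ge> 0)"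

definition maximal_monotone :: "('a::real_normed_vector, 'a dual) operator \<Rightarrow> bool" where
  "maximal_monotone A \<longleftrightarrow>
     monotone_op A \<and> (\<forall>B. monotone_op B \<longrightarrow> A \<subseteq> B \<longrightarrow> B = A)"

definition fitzpatrick ::
    "('a::real_normed_vector, 'a dual) operator \<Rightarrow> 'a \<times> 'a dual \<Rightarrow> ereal" where
  "fitzpatrick A z = (SUP a\<in>A. ereal (dual_prod z a - pairing a))"

definition NI_type :: "('a::real_normed_vector, 'a dual) operator \<Rightarrow> bool" where
  "NI_type A \<longleftrightarrow> A \<noteq> {} \<and> (\<forall>z. fitzpatrick A z \<ge> ereal (pairing z))"

definition adjoint_blinfun ::
    "'a::real_normed_vector \<Rightarrow>\<^sub>L 'b::real_normed_vector \<Rightarrow> 'b dual \<Rightarrow> 'a dual" where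
  "adjoint_blinfun L ystar = ystar o\<^sub>L L"

definition pullback_op ::
    "'a::real_normed_vector \<Rightarrow>\<^sub>L 'b::real_normed_vector
       \<Rightarrow> ('b, 'b dual) operator \<Rightarrow> ('a, 'a dual) operator" where
  "pullback_op L S =
     {(x, xstar). xstar \<in> adjoint_blinfun L ` values_at S (blinfun_apply L x)}"

definition normal_cone :: "'a::real_normed_vector set \<Rightarrow> ('a, 'a dual) operator" where
  "normal_cone C =
     {(x, xstar). x \<in> C \<and> (\<forall>y\<in>C. blinfun_apply xstar (y - x) \<le> 0)}"

(* Core of S relative to affine hull S: from x one can move a little way inside S
   towards every point of the affine hull. *)
definition rel_alg_interior :: "'a::real_vector set \<Rightarrow> 'a set" where
  "rel_alg_interior S =
     {x \<in> S. \<forall>y \<in> affine hull S. \<exists>\<delta>>0. \<forall>t\<in>{0..\<delta>}. x + t *\<^sub>R (y - x) \<in> S}"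

definition ic_interior :: "'a::real_normed_vector set \<Rightarrow> 'a set" where
  "ic_interior S = (if closed (affine hull S) then rel_alg_interior S else {})"

definition set_diff_alg :: "'a::minus set \<Rightarrow> 'a set \<Rightarrow> 'a set" where
  "set_diff_alg A B = {a - b | a b. a \<in> A \<and> b \<in> B}"

end

theory Submission
  imports Defs
begin

text \<open>
  Part \<open>(\<alpha>)\<close>: maximality gives \<open>M + N\<^bsub>D(M)\<^esub> = M\<close>, hence \<open>T + N\<^bsub>D(T)\<^esub> = T\<close>. A point
  \<open>z = (x, x')\<close> where the Fitzpatrick function of \<open>T\<close> is below the pairing satisfies
  \<open>p (z - a) \<ge> \<epsilon> > 0\<close> for all \<open>a \<in> T\<close>, so \<open>x \<notin> D(T)\<close>; but then some normal vector of \<open>D(T)\<close> at a point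
  \<open>a\<close> is positive at \<open>x - a\<close> (Ekeland), and its multiples can be added to \<open>T a\<close>, a contradiction.

  Maximality: if \<open>z = (x, x')\<close> is monotonically related to \<open>T\<close>, then by the NI property the
  Fitzpatrick function \<open>h\<^sub>T\<close> touches the pairing from above at \<open>z\<close>, so \<open>z\<close> is a subgradient of \<open>h\<^sub>T\<close>
  there. Since \<open>h\<^sub>T (u, L\<^sup>* y') \<le> h\<^sub>M (L u, y')\<close>, this bounds \<open>h\<^sub>M\<close> from below along \<open>R(L)\<close>, and under
  the interiority condition a Lagrange multiplier (a Robinson--Ursescu argument followed by
  Hahn--Banach) is a functional \<open>v\<close> with \<open>L\<^sup>* v = x'\<close> and \<open>(L x, v)\<close> monotonically related to \<open>M\<close>.
  The same multiplier rule proves the normal cone formula required by \<open>(\<alpha>)\<close>, with \<open>D(M)\<close> replaced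
  by any closed convex \<open>K \<supseteq> D(M)\<close> having the same preimage under \<open>L\<close>. In \<open>(\<beta>)\<close> one takes \<open>K = D(M)\<close>,
  in \<open>(\<gamma>)\<close> the closure of the projection of the domain of \<open>h\<^sub>M\<close>, whose interior lies in \<open>D(M)\<close>.
\<close>

section \<open>Hahn--Banach\<close>

text \<open>Homogeneity is only an inequality, which is what infima of families deliver; applying it
  to \<open>inverse t\<close> recovers equality.\<close>

definition sublinear :: "('a::real_vector \<Rightarrow> real) \<Rightarrow> bool" where
  "sublinear q \<longleftrightarrow> (\<forall>x y. q (x + y) \<le> q x + q y) \<and> (\<forall>t>0. \<forall>x. q (t *\<^sub>R x) \<le> t * q x)"

lemma sublinear_add: "sublinear q \<Longrightarrow> q (x + y) \<le> q x + q y"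
  by (simp add: sublinear_def)

lemma sublinear_scaleR:
  assumes "sublinear q" "t > 0"
  shows "q (t *\<^sub>R x) = t * q x"
proof (rule antisym)
  show "q (t *\<^sub>R x) \<le> t * q x"
    using assms by (simp add: sublinear_def)
  have "q (inverse t *\<^sub>R (t *\<^sub>R x)) \<le> inverse t * q (t *\<^sub>R x)"
    using assms by (meson positive_imp_inverse_positive sublinear_def)
  then show "t * q x \<le> q (t *\<^sub>R x)"
    using assms(2) by (simp add: field_simps)
qed

lemma sublinear_0: "sublinear q \<Longrightarrow> q 0 = 0"
  using sublinear_scaleR[of q 2 0] by simp

lemma sublinear_minus: "sublinear q \<Longrightarrow> - q (- x) \<le> q x"
  using sublinear_add[of q x "-x"] sublinear_0[of q] by simp

text \<open>The hypotheses speak of elements because infima need not be attained; passing to infima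
  over \<open>a\<close> and \<open>b\<close> gives the sublinear inequalities.\<close>

lemma sublinear_Inf:
  fixes S :: "'a::real_vector \<Rightarrow> real set"
  assumes ne: "\<And>x. S x \<noteq> {}"
    and bdd: "\<And>x. bdd_below (S x)"
    and add: "\<And>x y a b. a \<in> S x \<Longrightarrow> b \<in> S y \<Longrightarrow> \<exists>c\<in>S (x + y). c \<le> a + b"
    and scale: "\<And>x a t. a \<in> S x \<Longrightarrow> t > 0 \<Longrightarrow> \<exists>c\<in>S (t *\<^sub>R x). c \<le> t * a"
  shows "sublinear (\<lambda>x. Inf (S x))"
  unfolding sublinear_def
proof (intro conjI allI impI)
  fix x y
  have "Inf (S (x + y)) - a \<le> Inf (S y)" if a: "a \<in> S x" for a
  proof (rule cInf_greatest[OF ne])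
    fix b assume "b \<in> S y"
    then obtain c where "c \<in> S (x + y)" "c \<le> a + b"
      using add[OF a] by blast
    then show "Inf (S (x + y)) - a \<le> b"
      using cInf_lower[OF _ bdd] by (smt (verit))
  qed
  then have "Inf (S (x + y)) - Inf (S y) \<le> Inf (S x)"
    by (intro cInf_greatest[OF ne]) (smt (verit))
  then show "Inf (S (x + y)) \<le> Inf (S x) + Inf (S y)"
    by simp
next
  fix t :: real and x :: 'a
  assume t: "t > 0"
  have "Inf (S (t *\<^sub>R x)) / t \<le> Inf (S x)"
  proof (rule cInf_greatest[OF ne])
    fix a assume "a \<in> S x"
    then obtain c where "c \<in> S (t *\<^sub>R x)" "c \<le> t * a"
      using scale t by blast
    then show "Inf (S (t *\<^sub>R x)) / t \<le> a"
      using cInf_lower[OF _ bdd, of c "t *\<^sub>R x"] t by (simp add: field_simps)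
  qed
  then show "Inf (S (t *\<^sub>R x)) \<le> t * Inf (S x)"
    using t by (simp add: field_simps)
qed

text \<open>Replacing \<open>q\<close> by the sublinear function \<open>y \<mapsto> inf {q (y + t a) - t (q a)}\<close>, the infimum over
  \<open>t \<ge> 0\<close>, does not change a minimal \<open>q\<close>; the term \<open>t = 1\<close> then yields superadditivity.\<close>

lemma minimal_sublinear_linear:
  assumes q: "sublinear q"
    and minimal: "\<And>f. sublinear f \<Longrightarrow> (\<And>x. f x \<le> q x) \<Longrightarrow> f = q"
  shows "linear q"
proof -
  have add: "q (y + a) = q y + q a" for y a
  proof -
    define S where "S y = (\<lambda>t. q (y + t *\<^sub>R a) - t * q a) ` {0..}" for y
    have scale: "q (t *\<^sub>R x) = t * q x" if "t \<ge> 0" for t x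
      using that sublinear_scaleR[OF q] sublinear_0[OF q] by (cases "t = 0") auto
    have low: "- q (- y) \<le> c" if c: "c \<in> S y" for c y
    proof -
      obtain t where t: "t \<ge> 0" "c = q (y + t *\<^sub>R a) - t * q a"
        using c by (auto simp: S_def)
      then show ?thesis
        using sublinear_add[OF q, of "y + t *\<^sub>R a" "- y"] scale[of t a] by simp
    qed
    have bdd: "bdd_below (S y)" for y
      using low by (meson bdd_belowI)
    have in_S: "q (y + t *\<^sub>R a) - t * q a \<in> S y" if "t \<ge> 0" for y t
      using that by (auto simp: S_def)
    have "sublinear (\<lambda>y. Inf (S y))"
    proof (rule sublinear_Inf[OF _ bdd])
      show "S x \<noteq> {}" for x
        by (auto simp: S_def)
    next
      fix x y c d assume "c \<in> S x" "d \<in> S y"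
      then obtain s t where st: "s \<ge> 0" "c = q (x + s *\<^sub>R a) - s * q a"
        "t \<ge> 0" "d = q (y + t *\<^sub>R a) - t * q a"
        by (auto simp: S_def)
      have "q (x + y + (s + t) *\<^sub>R a) \<le> q (x + s *\<^sub>R a) + q (y + t *\<^sub>R a)"
        using sublinear_add[OF q, of "x + s *\<^sub>R a" "y + t *\<^sub>R a"]
        by (simp add: algebra_simps)
      then have "q (x + y + (s + t) *\<^sub>R a) - (s + t) * q a \<le> c + d"
        using st by (simp add: algebra_simps)
      then show "\<exists>e\<in>S (x + y). e \<le> c + d"
        using in_S[of "s + t" "x + y"] st by force
    next
      fix x c and r :: real assume "c \<in> S x" "r > 0"
      then obtain s where s: "s \<ge> 0" "c = q (x + s *\<^sub>R a) - s * q a"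
        by (auto simp: S_def)
      have "q (r *\<^sub>R x + (r * s) *\<^sub>R a) - (r * s) * q a = r * c"
        using sublinear_scaleR[OF q \<open>r > 0\<close>, of "x + s *\<^sub>R a"]
        unfolding s(2) by (simp add: algebra_simps)
      then show "\<exists>e\<in>S (r *\<^sub>R x). e \<le> r * c"
        using in_S[of "r * s" "r *\<^sub>R x"] s \<open>r > 0\<close> by force
    qed
    moreover have "Inf (S x) \<le> q x" for x
      using cInf_lower[OF in_S[of 0 x] bdd] by simp
    ultimately have "(\<lambda>y. Inf (S y)) = q"
      by (rule minimal)
    then have "q y \<le> q (y + a) - q a"
      using cInf_lower[OF in_S[of 1 y] bdd] by (metis le_numeral_extra(1) zero_le_one scaleR_one mult_1)
    then show ?thesis
      using sublinear_add[OF q, of y a] by simp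
  qed
  have neg: "q (- x) = - q x" for x
    using add[of x "- x"] sublinear_0[OF q] by simp
  have "q (t *\<^sub>R x) = t * q x" for t x
  proof (cases t "0::real" rule: linorder_cases)
    case less
    then show ?thesis
      using sublinear_scaleR[OF q, of "- t" x] neg[of "t *\<^sub>R x"] by simp
  qed (use sublinear_scaleR[OF q] sublinear_0[OF q] in auto)
  then show ?thesis
    using add by (intro linearI) auto
qed

text \<open>The function \<open>- q (- x)\<close> bounds every member below. For subadditivity, the
  smaller of two members of the chain serves at both points.\<close>

lemma sublinear_Inf_chain:
  fixes C :: "('a::real_vector \<Rightarrow> real) set"
  assumes "C \<noteq> {}" and subl: "\<And>f. f \<in> C \<Longrightarrow> sublinear f"
    and below: "\<And>f x. f \<in> C \<Longrightarrow> f x \<le> q x"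
    and chain: "\<And>f g. f \<in> C \<Longrightarrow> g \<in> C \<Longrightarrow> f \<le> g \<or> g \<le> f"
  shows "sublinear (\<lambda>x. INF f\<in>C. f x)" and "\<And>f x. f \<in> C \<Longrightarrow> (INF f\<in>C. f x) \<le> f x"
proof -
  have bdd: "bdd_below ((\<lambda>f. f x) ` C)" for x
  proof (rule bdd_belowI[of _ "- q (- x)"])
    fix c assume "c \<in> (\<lambda>f. f x) ` C"
    then obtain f where "f \<in> C" "c = f x"
      by blast
    then show "- q (- x) \<le> c"
      using sublinear_minus[OF subl, of f x] below[of f "- x"] by simp
  qed
  then show "\<And>f x. f \<in> C \<Longrightarrow> (INF f\<in>C. f x) \<le> f x"
    by (rule cINF_lower)
  show "sublinear (\<lambda>x. INF f\<in>C. f x)"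
  proof (rule sublinear_Inf[OF _ bdd])
    show "(\<lambda>f. f x) ` C \<noteq> {}" for x
      using assms(1) by blast
  next
    fix x y a b assume "a \<in> (\<lambda>f. f x) ` C" "b \<in> (\<lambda>f. f y) ` C"
    then obtain f g where fg: "f \<in> C" "a = f x" "g \<in> C" "b = g y"
      by blast
    then obtain h where h: "h \<in> C" "h \<le> f" "h \<le> g"
      using chain by blast
    have "h (x + y) \<le> a + b"
      using sublinear_add[OF subl[OF h(1)], of x y] h fg by (smt (verit) le_funD)
    then show "\<exists>c\<in>(\<lambda>f. f (x + y)) ` C. c \<le> a + b"
      using h by blast
  next
    fix x a and t :: real assume "a \<in> (\<lambda>f. f x) ` C" "t > 0"
    then show "\<exists>c\<in>(\<lambda>f. f (t *\<^sub>R x)) ` C. c \<le> t * a"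
      using subl unfolding sublinear_def by blast
  qed
qed

text \<open>Zorn's lemma for the reversed pointwise order gives a minimal sublinear function below
  \<open>q\<close>; minimality forces linearity.\<close>

theorem Hahn_Banach_sublinear:
  fixes q :: "'a::real_vector \<Rightarrow> real"
  assumes q: "sublinear q"
  obtains v where "linear v" "\<And>x. v x \<le> q x"
proof -
  define A where "A = {f. sublinear f \<and> (\<forall>x. f x \<le> q x)}"
  define P where "P = (\<lambda>f g :: 'a \<Rightarrow> real. g \<le> f)"
  have "\<exists>m\<in>A. \<forall>f\<in>A. P m f \<longrightarrow> f = m"
  proof (rule predicate_Zorn)
    show "partial_order_on A (relation_of P A)"
      by (rule partial_order_on_relation_ofI) (auto simp: P_def)
  next
    fix C assume C: "C \<in> Chains (relation_of P A)"
    then have CA: "C \<subseteq> A"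
      by (rule Chains_relation_of)
    show "\<exists>u\<in>A. \<forall>f\<in>C. P f u"
    proof (cases "C = {}")
      case True
      then show ?thesis
        using q by (auto simp: A_def)
    next
      case False
      have chain: "f \<le> g \<or> g \<le> f" if "f \<in> C" "g \<in> C" for f g
        using C that by (auto simp: Chains_def relation_of_def P_def)
      let ?u = "\<lambda>x. INF f\<in>C. f x"
      have u: "sublinear ?u" "\<And>f x. f \<in> C \<Longrightarrow> ?u x \<le> f x"
        using sublinear_Inf_chain[of C q] False CA chain by (auto simp: A_def)
      obtain f where "f \<in> C"
        using False by blast
      then have "?u x \<le> q x" for x
        using u(2)[of f x] CA by (auto simp: A_def intro: order_trans)
      then have "?u \<in> A"
        using u(1) by (simp add: A_def)
      then show ?thesis
        by (intro bexI[of _ ?u] ballI) (use u(2) in \<open>simp_all add: P_def le_fun_def\<close>)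
    qed
  qed
  then obtain m where m: "m \<in> A" "\<And>f. f \<in> A \<Longrightarrow> f \<le> m \<Longrightarrow> f = m"
    unfolding P_def by blast
  have "linear m"
  proof (rule minimal_sublinear_linear)
    show "sublinear m"
      using m(1) by (simp add: A_def)
    fix f assume "sublinear f" "\<And>x. f x \<le> m x"
    then show "f = m"
      using m by (smt (verit) A_def le_funI mem_Collect_eq)
  qed
  then show ?thesis
    using m(1) that by (auto simp: A_def)
qed

section \<open>Robinson--Ursescu and Lagrange multipliers\<close>

text \<open>The preimage of \<open>w\<close> is the series \<open>\<Sum>k. 2\<^sup>-\<^sup>k\<^sup>-\<^sup>1 g\<^sub>k\<close>, where \<open>f g\<^sub>k\<close>
  approximates the rescaled remainder \<open>e\<^sub>k\<close> after \<open>k\<close> steps.\<close>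

lemma convex_image_ball_from_closure:
  fixes f :: "'c::banach \<Rightarrow> 'd::real_normed_vector"
  assumes "bounded_linear f" "closed G" "convex G" "bounded G" "subspace E"
    and sub: "f ` G \<subseteq> E" and cl: "ball 0 \<delta> \<inter> E \<subseteq> closure (f ` G)"
  shows "ball 0 (\<delta>/2) \<inter> E \<subseteq> f ` G"
proof
  fix w assume w: "w \<in> ball 0 (\<delta>/2) \<inter> E"
  interpret f: bounded_linear f by fact
  have \<delta>: "\<delta> > 0"
  proof -
    have "norm w < \<delta>/2"
      using w by simp
    then show ?thesis
      using norm_ge_zero[of w] by linarith
  qed
  have "\<exists>g\<in>G. dist (f g) e < \<delta>/2" if "e \<in> ball 0 \<delta> \<inter> E" for e
  proof -
    have "e \<in> closure (f ` G)"
      using cl that by blast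
    then have "\<exists>y\<in>f ` G. dist y e < \<delta>/2"
      using \<delta> by (simp only: closure_approachable half_gt_zero)
    then show ?thesis
      by blast
  qed
  then obtain \<gamma> where \<gamma>: "\<And>e. e \<in> ball 0 \<delta> \<inter> E \<Longrightarrow> \<gamma> e \<in> G \<and> dist (f (\<gamma> e)) e < \<delta>/2"
    by metis
  \<comment> \<open>Invariant: \<open>e n\<close> is the remainder \<open>w - f (s n)\<close>
    magnified by \<open>2^(n+1)\<close>. The weights sum to 1, so \<open>e\<close> starts at
    \<open>2 *\<^sub>R w\<close>, which costs half the radius.\<close>
  define e where "e = rec_nat (2 *\<^sub>R w) (\<lambda>_ e. 2 *\<^sub>R (e - f (\<gamma> e)))"
  define g where "g k = \<gamma> (e k)" for k
  have e0: "e 0 = 2 *\<^sub>R w" and eS: "e (Suc k) = 2 *\<^sub>R (e k - f (g k))" for k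
    by (simp_all add: e_def g_def)
  have e_in: "e k \<in> ball 0 \<delta> \<inter> E" for k
  proof (induction k)
    case 0
    then show ?case
      using w \<open>subspace E\<close> by (auto simp: e0 subspace_scale)
  next
    case (Suc k)
    then have "dist (f (g k)) (e k) < \<delta>/2" "g k \<in> G"
      using \<gamma> by (auto simp: g_def)
    then show ?case
      using Suc sub \<open>subspace E\<close>
      by (auto simp: eS dist_norm norm_minus_commute intro!: subspace_scale subspace_diff)
  qed
  have gG: "g k \<in> G" for k
    using \<gamma>[OF e_in] by (simp add: g_def)
  obtain B where B: "\<And>x. x \<in> G \<Longrightarrow> norm x \<le> B"
    using \<open>bounded G\<close> by (auto simp: bounded_iff)
  define s where "s n = (\<Sum>k<n. (1/2)^Suc k *\<^sub>R g k)" for n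
  have "summable (\<lambda>k. (1/2)^Suc k *\<^sub>R g k)"
  proof (rule summable_comparison_test')
    show "summable (\<lambda>k. (1/2)^Suc k * B)"
      by (intro summable_mult2) (simp add: summable_geometric)
    show "norm ((1/2)^Suc k *\<^sub>R g k) \<le> (1/2)^Suc k * B" if "k \<ge> 0" for k
      using B[OF gG[of k]] by (simp add: mult_left_mono)
  qed
  then obtain h where h: "s \<longlonglongrightarrow> h"
    unfolding s_def using summable_LIMSEQ by blast
  \<comment> \<open>The partial sum lacks the weight \<open>(1/2)^n\<close>; any point of
    \<open>G\<close> completes it to a convex combination.\<close>
  have mem: "s n + (1/2)^n *\<^sub>R x \<in> G" if "x \<in> G" for n x
    using that
  proof (induction n arbitrary: x)
    case 0
    then show ?case by (simp add: s_def)
  next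
    case (Suc n)
    have "(1/2) *\<^sub>R g n + (1/2) *\<^sub>R x \<in> G"
      using \<open>convex G\<close> gG Suc.prems by (intro convexD) auto
    from Suc.IH[OF this] show ?case
      by (simp add: s_def algebra_simps)
  qed
  have pow: "(\<lambda>n. (1/2::real)^n) \<longlonglongrightarrow> 0"
    by (simp add: LIMSEQ_realpow_zero)
  have "(\<lambda>n. s n + (1/2)^n *\<^sub>R g 0) \<longlonglongrightarrow> h + 0 *\<^sub>R g 0"
    by (intro tendsto_intros h pow)
  then have hG: "h \<in> G"
    using closed_sequentially[OF \<open>closed G\<close>, of "\<lambda>n. s n + (1/2)^n *\<^sub>R g 0"] mem gG by simp
  have fs: "f (s n) = w - (1/2)^Suc n *\<^sub>R e n" for n
  proof (induction n)
    case 0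
    then show ?case by (simp add: s_def e0 f.zero)
  next
    case (Suc n)
    have "f (s (Suc n)) = f (s n) + (1/2)^Suc n *\<^sub>R f (g n)"
      by (simp add: s_def f.add f.scaleR)
    also have "\<dots> = w - (1/2)^Suc n *\<^sub>R (e n - f (g n))"
      by (simp add: Suc algebra_simps)
    finally show ?case
      by (simp add: eS)
  qed
  have "(\<lambda>n. (1/2)^Suc n *\<^sub>R e n) \<longlonglongrightarrow> 0"
  proof (rule Lim_null_comparison)
    show "\<forall>\<^sub>F n in sequentially. norm ((1/2)^Suc n *\<^sub>R e n) \<le> (1/2)^n * \<delta>"
    proof (intro always_eventually allI)
      fix n
      have "norm (e n) \<le> 2 * \<delta>"
        using e_in[of n] \<delta> by auto
      then show "norm ((1/2)^Suc n *\<^sub>R e n) \<le> (1/2)^n * \<delta>"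
        by (simp add: field_simps)
    qed
    show "(\<lambda>n. (1/2)^n * \<delta>) \<longlonglongrightarrow> 0"
      using tendsto_mult_right[OF pow, of \<delta>] by simp
  qed
  then have "(\<lambda>n. f (s n)) \<longlonglongrightarrow> w"
    unfolding fs using tendsto_diff[OF tendsto_const[of w]] by fastforce
  moreover have "(\<lambda>n. f (s n)) \<longlonglongrightarrow> f h"
    by (rule f.tendsto[OF h])
  ultimately have "w = f h"
    using LIMSEQ_unique by blast
  then show "w \<in> f ` G"
    using hG by blast
qed

text \<open>Baire's theorem in \<open>E\<close> gives some dilated closure an interior point
  \<open>x\<close>. A convex combination with a positive multiple of \<open>- x\<close>, taken from
  some \<open>S m\<close>, moves the ball to the origin.\<close>

lemma absorbing_closed_seq_has_ball:
  fixes S :: "nat \<Rightarrow> 'd::banach set"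
  assumes "closed E" "subspace E"
    and sub: "\<And>n. S n \<subseteq> E" and conv: "\<And>n. convex (S n)" and mono: "mono S"
    and abs: "\<And>e. e \<in> E \<Longrightarrow> \<exists>n. \<exists>t>0. t *\<^sub>R e \<in> S n"
  obtains n \<delta> where "\<delta> > 0" "ball 0 \<delta> \<inter> E \<subseteq> closure (S n)"
proof -
  define T where "T n = {e \<in> E. inverse (real (Suc n)) *\<^sub>R e \<in> closure (S n)}" for n
  obtain n0 where n0: "0 \<in> S n0"
    using abs[of 0] subspace_0[OF \<open>subspace E\<close>] by auto
  have cover: "\<Union>(range T) = E"
  proof (intro equalityI subsetI)
    fix e assume e: "e \<in> E"
    then obtain n t where nt: "t > 0" "t *\<^sub>R e \<in> S n"
      using abs by blast
    obtain m where m: "inverse (real (Suc m)) < t"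
      using reals_Archimedean[OF nt(1)] by blast
    \<comment> \<open>\<open>n0\<close> puts 0 into \<open>S N\<close>, so convexity allows
      \<open>t *\<^sub>R e\<close> to be shrunk; \<open>m\<close> makes the new factor small
      enough.\<close>
    define N where "N = max (max m n) n0"
    have "n \<le> N" "n0 \<le> N"
      by (simp_all add: N_def)
    then have "t *\<^sub>R e \<in> S N" "0 \<in> S N"
      using monoD[OF mono] nt(2) n0 by blast+
    moreover have "inverse (real (Suc N)) \<le> t"
    proof -
      have "inverse (real (Suc N)) \<le> inverse (real (Suc m))"
        by (intro le_imp_inverse_le) (auto simp: N_def)
      then show ?thesis
        using m by linarith
    qed
    ultimately have "(inverse (real (Suc N)) / t) *\<^sub>R (t *\<^sub>R e)
        + (1 - inverse (real (Suc N)) / t) *\<^sub>R 0 \<in> S N"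
      using nt(1) by (intro convexD[OF conv]) (auto simp: divide_simps mult.commute)
    then have "inverse (real (Suc N)) *\<^sub>R e \<in> S N"
      using nt(1) by simp
    then have "e \<in> T N"
      using e closure_subset by (auto simp: T_def)
    then show "e \<in> \<Union>(range T)"
      by blast
  qed (auto simp: T_def)
  have "closed (T n)" for n
  proof -
    have "T n = E \<inter> (\<lambda>e. inverse (real (Suc n)) *\<^sub>R e) -` closure (S n)"
      by (auto simp: T_def)
    moreover have "closed ((\<lambda>e. inverse (real (Suc n)) *\<^sub>R e) -` closure (S n))"
      by (intro continuous_closed_vimage continuous_intros) auto
    ultimately show ?thesis
      using \<open>closed E\<close> by (metis closed_Int)
  qed
  then have closedin: "closedin (top_of_set E) (T n)" for n
    by (metis (no_types, lifting) T_def closed_subset mem_Collect_eq subsetI)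
  have "\<exists>n. (top_of_set E) interior_of (T n) \<noteq> {}"
  proof (rule ccontr)
    assume "\<not> ?thesis"
    then have "(top_of_set E) interior_of \<Union>(range T) = {}"
      using closedin \<open>closed E\<close>
      by (intro Baire_category_alt disjI1 completely_metrizable_space_closedin
          completely_metrizable_space_euclidean) auto
    moreover have "(top_of_set E) interior_of E = E"
      by (metis interior_of_topspace topspace_euclidean_subtopology)
    ultimately show False
      using cover subspace_0[OF \<open>subspace E\<close>] by auto
  qed
  then obtain n x where "x \<in> (top_of_set E) interior_of (T n)"
    by blast
  then obtain U where "openin (top_of_set E) U" "x \<in> U" "U \<subseteq> T n"
    by (auto simp: interior_of_def)
  then obtain r where r: "r > 0" "ball x r \<inter> E \<subseteq> T n" and xE: "x \<in> E"
    by (metis (no_types, lifting) openin_contains_ball subset_trans subsetD)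
  define k where "k = real (Suc n)"
  have k: "k > 0"
    by (simp add: k_def)
  obtain m t where mt: "t > 0" "t *\<^sub>R (- x) \<in> S m"
    using abs[of "- x"] xE \<open>subspace E\<close> by (meson subspace_neg)
  define N where "N = max m n"
  have "- t *\<^sub>R x \<in> closure (S N)"
    using monoD[OF mono, of m N] mt(2) closure_subset by (fastforce simp: N_def)
  have nN: "closure (S n) \<subseteq> closure (S N)"
    using monoD[OF mono, of n N] by (simp add: N_def closure_mono)
  \<comment> \<open>Chosen so that \<open>\<theta> / k = (1 - \<theta>) * t\<close>, which cancels
    \<open>x\<close> in the combination below.\<close>
  define \<theta> where "\<theta> = t * k / (1 + t * k)"
  have \<theta>: "0 < \<theta>" "\<theta> < 1"
    using mt(1) k by (auto simp: \<theta>_def add_pos_pos)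
  have "ball 0 (\<theta> * r / k) \<inter> E \<subseteq> closure (S N)"
  proof
    fix w assume w: "w \<in> ball 0 (\<theta> * r / k) \<inter> E"
    define y where "y = x + (k / \<theta>) *\<^sub>R w"
    have "norm ((k / \<theta>) *\<^sub>R w) < r"
      using w k \<theta> by (simp add: field_simps)
    then have "y \<in> ball x r \<inter> E"
      using w xE \<open>subspace E\<close> by (auto simp: y_def dist_norm intro!: subspace_add subspace_scale)
    then have "y \<in> T n"
      using r by blast
    then have "inverse k *\<^sub>R y \<in> closure (S N)"
      using nN by (auto simp: T_def k_def)
    then have "\<theta> *\<^sub>R (inverse k *\<^sub>R y) + (1 - \<theta>) *\<^sub>R (- t *\<^sub>R x) \<in> closure (S N)"
      using \<theta> \<open>- t *\<^sub>R x \<in> closure (S N)\<close> by (intro convexD convex_closure conv) auto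
    moreover have "\<theta> *\<^sub>R (inverse k *\<^sub>R y) + (1 - \<theta>) *\<^sub>R (- t *\<^sub>R x) = w"
    proof -
      have "\<theta> * inverse k = (1 - \<theta>) * t"
      proof -
        have "1 + t * k \<noteq> 0"
          using mult_pos_pos[OF mt(1) k] by linarith
        then show ?thesis
          using k by (simp add: \<theta>_def divide_simps)
      qed
      then show ?thesis
        using k \<theta> by (simp add: y_def scaleR_add_right)
    qed
    ultimately show "w \<in> closure (S N)"
      by simp
  qed
  moreover have "\<theta> * r / k > 0"
    using \<theta> r k by simp
  ultimately show ?thesis
    using that by blast
qed

text \<open>Images of bounded slices of \<open>G\<close> absorb \<open>E\<close>. Baire puts a ball
  of \<open>E\<close> into the closure of one image, and the series argument removes the closure;
  the slice supplies the bound \<open>N\<close>.\<close>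

theorem Robinson_Ursescu:
  fixes f :: "'c::banach \<Rightarrow> 'd::banach"
  assumes f: "bounded_linear f" and G: "closed G" "convex G" and E: "closed E" "subspace E"
    and abs: "\<And>e. e \<in> E \<Longrightarrow> \<exists>t>0. \<exists>g\<in>G. f g = t *\<^sub>R e"
  obtains \<delta> N where "\<delta> > 0" "\<And>w. w \<in> E \<Longrightarrow> norm w < \<delta> \<Longrightarrow> \<exists>g\<in>G. norm g \<le> N \<and> f g = w"
proof -
  interpret f: bounded_linear f by fact
  \<comment> \<open>The preimage of \<open>E\<close> is intersected as well because \<open>f\<close>
    may map \<open>G\<close> outside \<open>E\<close>.\<close>
  define H where "H n = G \<inter> cball 0 (real n) \<inter> f -` E" for n :: nat
  have H: "closed (H n)" "convex (H n)" "bounded (H n)" "f ` H n \<subseteq> E" for n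
  proof -
    have "closed (f -` E)"
      using E(1) f.continuous_on by (intro continuous_closed_vimage) (auto simp: f.isCont)
    then show "closed (H n)"
      using G by (auto simp: H_def)
    show "convex (H n)"
      unfolding H_def using G E f.linear
      by (intro convex_Int convex_linear_vimage convex_cball) (auto intro: subspace_imp_convex)
    show "bounded (H n)"
      unfolding H_def by (meson bounded_cball bounded_subset inf_le1 inf_le2)
  qed (auto simp: H_def)
  have "mono (\<lambda>n. f ` H n)"
    by (intro monoI image_mono) (auto simp: H_def)
  moreover have "\<exists>n. \<exists>t>0. t *\<^sub>R e \<in> f ` H n" if e: "e \<in> E" for e
  proof -
    obtain t g where tg: "t > 0" "g \<in> G" "f g = t *\<^sub>R e"
      using abs[OF e] by blast
    obtain n where "norm g \<le> real n"
      using real_arch_simple by blast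
    then have "g \<in> H n"
      using tg e E by (auto simp: H_def subspace_scale)
    then show ?thesis
      using tg by (metis image_eqI)
  qed
  ultimately obtain n \<delta> where \<delta>: "\<delta> > 0" "ball 0 \<delta> \<inter> E \<subseteq> closure (f ` H n)"
    using absorbing_closed_seq_has_ball[OF E, of "\<lambda>n. f ` H n"] H f.linear
    by (metis convex_linear_image)
  have "ball 0 (\<delta>/2) \<inter> E \<subseteq> f ` H n"
    by (intro convex_image_ball_from_closure f H E \<delta>)
  then show ?thesis
    using \<delta>(1) that[of "\<delta>/2" "real n"] by (force simp: H_def)
qed

text \<open>The multiplier is a linear functional below the sublinear function
  \<open>y \<mapsto> inf {t r + C \<parallel>y - t w\<parallel>}\<close>, the infimum over \<open>t > 0\<close> and \<open>(c, w, r) \<in> G\<close> with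
  \<open>w \<in> E\<close>; the second summand makes it continuous and extends it from \<open>E\<close> to the whole space.\<close>

theorem Lagrange_multiplier:
  fixes G :: "('c::banach \<times> 'd::banach \<times> real) set"
  assumes G: "closed G" "convex G" and E: "closed E" "subspace E"
    and nonneg: "\<And>c r. (c, 0, r) \<in> G \<Longrightarrow> 0 \<le> r"
    and abs: "\<And>e. e \<in> E \<Longrightarrow> \<exists>t>0. \<exists>c r. (c, t *\<^sub>R e, r) \<in> G"
  obtains v :: "'d dual" where "\<And>c w r. (c, w, r) \<in> G \<Longrightarrow> w \<in> E \<Longrightarrow> blinfun_apply v w \<le> r"
proof -
  have "bounded_linear (\<lambda>g :: 'c \<times> 'd \<times> real. fst (snd g))"
    by (intro bounded_linear_compose[OF bounded_linear_fst bounded_linear_snd])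
  moreover have "\<exists>t>0. \<exists>g\<in>G. fst (snd g) = t *\<^sub>R e" if "e \<in> E" for e
    using abs[OF that] by (metis fst_conv snd_conv)
  ultimately obtain \<delta> N where \<delta>: "\<delta> > 0"
    and ball: "\<And>w. w \<in> E \<Longrightarrow> norm w < \<delta> \<Longrightarrow> \<exists>g\<in>G. norm g \<le> N \<and> fst (snd g) = w"
    using Robinson_Ursescu[OF _ G E, of "\<lambda>g. fst (snd g)"] by blast
  have ball': "\<exists>c r. (c, w, r) \<in> G \<and> r \<le> N" if w: "w \<in> E" "norm w < \<delta>" for w
  proof -
    obtain g where g: "g \<in> G" "norm g \<le> N" "fst (snd g) = w"
      using ball[OF w] by blast
    obtain c r where "g = (c, w, r)"
      using g(3) by (metis prod.collapse)
    moreover have "r \<le> norm (w, r)" "norm (w, r) \<le> norm (c, w, r)"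
      using norm_snd_le[of r w] norm_snd_le[of "(w, r)" c] by auto
    ultimately show ?thesis
      using g by (metis order_trans)
  qed
  obtain c0 r0 where cr0: "(c0, 0, r0) \<in> G" "r0 \<le> N"
    using ball'[of 0] \<delta> subspace_0[OF E(2)] by auto
  then have N: "N \<ge> 0"
    using nonneg by fastforce
  define C where "C = 2 * N / \<delta>"
  have C: "C \<ge> 0"
    using N \<delta> by (simp add: C_def)
  \<comment> \<open>For \<open>w\<close> nonzero, some point of \<open>G\<close> over
    \<open>- s *\<^sub>R w\<close>, of norm \<delta>/2, has last coordinate at most
    \<open>N\<close>. Mixed with \<open>(c, w, r)\<close> it lies over 0, where
    \<open>nonneg\<close> yields \<open>r \<ge> - N / s\<close>; this explains
    \<open>C\<close>.\<close>
  have lower: "- C * norm w \<le> r" if g: "(c, w, r) \<in> G" and w: "w \<in> E" for c w r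
  proof (cases "w = 0")
    case True
    then show ?thesis
      using nonneg g by auto
  next
    case False
    define s where "s = \<delta> / (2 * norm w)"
    have s: "s > 0"
      using False \<delta> by (simp add: s_def)
    have "norm (- s *\<^sub>R w) < \<delta>"
      using False \<delta> by (simp add: s_def)
    then obtain c' r' where g': "(c', - s *\<^sub>R w, r') \<in> G" "r' \<le> N"
      using ball' w E(2) subspace_scale by blast
    have "(1 / (1 + s)) *\<^sub>R (c', - s *\<^sub>R w, r') + (s / (1 + s)) *\<^sub>R (c, w, r) \<in> G"
      using s by (intro convexD[OF G(2)] g g') (auto simp: divide_simps)
    then have "((1 / (1 + s)) *\<^sub>R c' + (s / (1 + s)) *\<^sub>R c, 0, (r' + s * r) / (1 + s)) \<in> G"
      by (simp add: add_divide_distrib)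
    then have "(r' + s * r) / (1 + s) \<ge> 0"
      by (rule nonneg)
    then have "s * r \<ge> - N"
      using s g' by (simp add: zero_le_divide_iff)
    then have "r \<ge> - N / s"
      using s by (simp add: field_simps)
    then show ?thesis
      by (simp add: s_def C_def mult_ac)
  qed
  define S where
    "S y = {t * r + C * norm (y - t *\<^sub>R w) | t c w r. t > 0 \<and> (c, w, r) \<in> G \<and> w \<in> E}" for y
  have S_mem: "t * r + C * norm (y - t *\<^sub>R w) \<in> S y" if "t > 0" "(c, w, r) \<in> G" "w \<in> E" for t c w r y
    using that by (auto simp: S_def)
  have low: "- C * norm y \<le> b" if "b \<in> S y" for b y
  proof -
    obtain t c w r where b: "b = t * r + C * norm (y - t *\<^sub>R w)" "t > 0" "(c, w, r) \<in> G" "w \<in> E"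
      using \<open>b \<in> S y\<close> by (auto simp: S_def)
    have "norm (t *\<^sub>R w) \<le> norm y + norm (y - t *\<^sub>R w)"
      using norm_triangle_ineq4[of y "y - t *\<^sub>R w"] by simp
    then have "C * (t * norm w) \<le> C * (norm y + norm (y - t *\<^sub>R w))"
      using C b(2) by (intro mult_left_mono) auto
    moreover have "t * (- C * norm w) \<le> t * r"
      using lower[OF b(3,4)] b(2) by (intro mult_left_mono) auto
    ultimately show ?thesis
      using b(1) by (simp add: algebra_simps)
  qed
  have bdd: "bdd_below (S y)" for y
    using low by (meson bdd_belowI)
  have "sublinear (\<lambda>y. Inf (S y))"
  proof (rule sublinear_Inf[OF _ bdd])
    show "S x \<noteq> {}" for x
      using S_mem[of 1 c0 0 r0 x] cr0 subspace_0[OF E(2)] by auto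
  next
    fix x y a b assume "a \<in> S x" "b \<in> S y"
    then obtain t c w r t' c' w' r' where
      a: "a = t * r + C * norm (x - t *\<^sub>R w)" "t > 0" "(c, w, r) \<in> G" "w \<in> E" and
      b: "b = t' * r' + C * norm (y - t' *\<^sub>R w')" "t' > 0" "(c', w', r') \<in> G" "w' \<in> E"
      unfolding S_def by blast
    define u where "u = t + t'"
    have u: "u > 0"
      using a b by (simp add: u_def)
    have "(t / u) *\<^sub>R (c, w, r) + (t' / u) *\<^sub>R (c', w', r') \<in> G"
      using a b u by (intro convexD[OF G(2)]) (auto simp: u_def add_divide_distrib[symmetric])
    then have mem: "((t / u) *\<^sub>R c + (t' / u) *\<^sub>R c', (t / u) *\<^sub>R w + (t' / u) *\<^sub>R w',
        (t / u) * r + (t' / u) * r') \<in> G"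
      by simp
    have mem': "(t / u) *\<^sub>R w + (t' / u) *\<^sub>R w' \<in> E"
      using a b E by (intro subspace_add subspace_scale)
    have eq: "u *\<^sub>R ((t / u) *\<^sub>R w + (t' / u) *\<^sub>R w') = t *\<^sub>R w + t' *\<^sub>R w'"
      "u * ((t / u) * r + (t' / u) * r') = t * r + t' * r'"
      using u by (simp_all add: scaleR_add_right field_simps)
    have "t * r + t' * r' + C * norm (x + y - (t *\<^sub>R w + t' *\<^sub>R w')) \<in> S (x + y)"
      using S_mem[OF u mem mem', of "x + y"] unfolding eq .
    moreover have "C * norm (x + y - (t *\<^sub>R w + t' *\<^sub>R w'))
        \<le> C * (norm (x - t *\<^sub>R w) + norm (y - t' *\<^sub>R w'))"
      using norm_triangle_ineq[of "x - t *\<^sub>R w" "y - t' *\<^sub>R w'"] C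
      by (intro mult_left_mono) (simp_all add: algebra_simps)
    ultimately show "\<exists>d\<in>S (x + y). d \<le> a + b"
      unfolding a(1) b(1)
      by (intro bexI[of _ "t * r + t' * r' + C * norm (x + y - (t *\<^sub>R w + t' *\<^sub>R w'))"])
        (simp_all add: algebra_simps)
  next
    fix x a and k :: real assume "a \<in> S x" "k > 0"
    then obtain t c w r where
      a: "a = t * r + C * norm (x - t *\<^sub>R w)" "t > 0" "(c, w, r) \<in> G" "w \<in> E"
      unfolding S_def by blast
    have "k * t * r + C * norm (k *\<^sub>R x - (k * t) *\<^sub>R w) \<in> S (k *\<^sub>R x)"
      using S_mem[of "k * t"] a \<open>k > 0\<close> by simp
    moreover have "norm (k *\<^sub>R x - (k * t) *\<^sub>R w) = k * norm (x - t *\<^sub>R w)"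
      using \<open>k > 0\<close> norm_scaleR[of k "x - t *\<^sub>R w"] by (simp add: scaleR_diff_right)
    ultimately have "k * a \<in> S (k *\<^sub>R x)"
      using a(1) by (simp add: algebra_simps)
    then show "\<exists>d\<in>S (k *\<^sub>R x). d \<le> k * a"
      by blast
  qed
  then obtain v where v: "linear v" "\<And>y. v y \<le> Inf (S y)"
    using Hahn_Banach_sublinear by blast
  then have v_le: "v y \<le> b" if "b \<in> S y" for b y
    using cInf_lower[OF that bdd] by (meson order_trans)
  have v_bound: "v y \<le> C * norm y" for y
  \<comment> \<open>Scaling the point of \<open>G\<close> over 0 by a small \<open>t\<close> makes
    its contribution \<open>t * r0\<close> at most \<open>e\<close>.\<close>
  proof (rule field_le_epsilon)
    fix e :: real assume e: "e > 0"
    define t where "t = e / (r0 + 1)"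
    have r0: "r0 \<ge> 0"
      using nonneg cr0 by blast
    then have t: "t > 0" "t * r0 \<le> e"
      using e by (auto simp: t_def field_simps)
    show "v y \<le> C * norm y + e"
      using v_le[OF S_mem[OF t(1) cr0(1)], of y] t(2) subspace_0[OF E(2)] by simp
  qed
  interpret v: linear v
    by fact
  have "bounded_linear v"
  proof (intro bounded_linear_intro)
    show "norm (v y) \<le> norm y * C" for y
      using v_bound[of y] v_bound[of "- y"] by (simp add: v.neg abs_le_iff mult.commute)
  qed (simp_all add: v.add v.scale)
  \<comment> \<open>For \<open>t = 1\<close> and \<open>y = w\<close> the norm term
    vanishes.\<close>
  moreover have "v w \<le> r" if "(c, w, r) \<in> G" "w \<in> E" for c w r
    using v_le[OF S_mem[of 1, OF _ that], of w] by simp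
  ultimately show ?thesis
    using that[of "Blinfun v"] by (simp add: bounded_linear_Blinfun_apply)
qed

section \<open>Normal vectors of closed convex sets\<close>

text \<open>Each step moves to a near-minimizer of \<open>f\<close> on \<open>S a\<close>. The
  nested sets \<open>S (x n)\<close> shrink to a single point \<open>a\<close>, and any
  \<open>y\<close> in \<open>S a\<close> would be a common point too, hence equal to
  \<open>a\<close>.\<close>

theorem Ekeland:
  fixes f :: "'a::complete_space \<Rightarrow> real"
  assumes "closed D" "D \<noteq> {}" "continuous_on D f" "bdd_below (f ` D)" "\<epsilon> > 0"
  obtains a where "a \<in> D" "\<And>y. y \<in> D \<Longrightarrow> f a \<le> f y + \<epsilon> * dist y a"
proof -
  define S where "S a = {y \<in> D. f y + \<epsilon> * dist y a \<le> f a}" for a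
  have S_refl: "a \<in> S a" if "a \<in> D" for a
    using that by (simp add: S_def)
  have S_trans: "S b \<subseteq> S a" if "b \<in> S a" for a b
  proof
    fix y assume y: "y \<in> S b"
    have "\<epsilon> * dist y a \<le> \<epsilon> * (dist y b + dist b a)"
      using assms(5) by (intro mult_left_mono dist_triangle) auto
    then show "y \<in> S a"
      using y that by (auto simp: S_def algebra_simps)
  qed
  have bdd: "bdd_below (f ` S a)" for a
    by (rule bdd_below_mono[OF assms(4)]) (auto simp: S_def)
  have "\<exists>b\<in>S a. f b < Inf (f ` S a) + e" if "a \<in> D" "e > 0" for a e
    using cInf_lessD[of "f ` S a" "Inf (f ` S a) + e"] S_refl[OF that(1)] that(2) by auto
  then obtain \<nu> where \<nu>: "\<And>a e. a \<in> D \<Longrightarrow> e > 0 \<Longrightarrow> \<nu> a e \<in> S a \<and> f (\<nu> a e) < Inf (f ` S a) + e"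
    by metis
  obtain d where d: "d \<in> D"
    using assms(2) by blast
  define x where "x = rec_nat d (\<lambda>n a. \<nu> a ((1/2)^n))"
  have xS: "x (Suc n) = \<nu> (x n) ((1/2)^n)" for n
    by (simp add: x_def)
  have xD: "x n \<in> D" for n
  proof (induction n)
    case 0
    then show ?case
      using d by (simp add: x_def)
  next
    case (Suc n)
    then show ?case
      using \<nu>[of "x n" "(1/2)^n"] by (simp add: xS S_def)
  qed
  have step: "x (Suc n) \<in> S (x n)" "f (x (Suc n)) < Inf (f ` S (x n)) + (1/2)^n" for n
    using \<nu>[OF xD, of "(1/2)^n" n] by (simp_all add: xS)
  have nested: "S (x n) \<subseteq> S (x m)" if "m \<le> n" for m n
    using lift_Suc_antimono_le[of "\<lambda>n. S (x n)", OF S_trans[OF step(1)] that] .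
  \<comment> \<open>On \<open>S (x n)\<close>, which contains \<open>y\<close>, the value
    \<open>f (x (Suc n))\<close> is within \<open>(1/2)^n\<close> of the infimum; the decrease still
    possible bounds the distance.\<close>
  have small: "\<epsilon> * dist y (x (Suc n)) \<le> (1/2)^n" if y: "y \<in> S (x (Suc n))" for y n
  proof -
    have "y \<in> S (x n)"
      using y nested[of n "Suc n"] by auto
    then have "Inf (f ` S (x n)) \<le> f y"
      using bdd by (simp add: cInf_lower)
    then show ?thesis
      using step(2)[of n] y by (auto simp: S_def)
  qed
  have "\<exists>a. \<Inter>(range (\<lambda>n. S (x n))) = {a}"
  proof (rule decreasing_closed_nest_sing)
    show "closed (S (x n))" for n
      unfolding S_def
      by (intro continuous_on_closed_Collect_le assms continuous_intros)
    show "S (x n) \<noteq> {}" for n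
      using S_refl[OF xD] by blast
    show "S (x n) \<subseteq> S (x m)" if "m \<le> n" for m n
      by (rule nested[OF that])
    fix e :: real assume e: "e > 0"
    obtain n where n: "(1/2)^n < \<epsilon> * e / 2"
      using real_arch_pow_inv[of "\<epsilon> * e / 2" "1/2"] assms(5) e by auto
    have near: "dist y (x (Suc n)) < e / 2" if "y \<in> S (x (Suc n))" for y
    proof -
      have "\<epsilon> * dist y (x (Suc n)) < \<epsilon> * (e / 2)"
        using small[OF that] n by simp
      then show ?thesis
        using assms(5) by (simp only: mult_less_cancel_left_pos)
    qed
    show "\<exists>n. \<forall>y\<in>S (x n). \<forall>z\<in>S (x n). dist y z < e"
      using near dist_triangle_half_l by blast
  qed
  then obtain a where a: "\<Inter>(range (\<lambda>n. S (x n))) = {a}"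
    by blast
  then have aS: "a \<in> S (x n)" for n
    by blast
  show ?thesis
  proof
    show "a \<in> D"
      using aS[of 0] by (simp add: S_def)
    fix y assume y: "y \<in> D"
    show "f a \<le> f y + \<epsilon> * dist y a"
    proof (rule ccontr)
      assume less: "\<not> ?thesis"
      then have "y \<in> S a"
        using y by (simp add: S_def)
      then have "y = a"
        using a S_trans[OF aS] by blast
      then show False
        using less by simp
    qed
  qed
qed

lemma mem_normal_cone_iff:
  "(x, x') \<in> normal_cone C \<longleftrightarrow> x \<in> C \<and> (\<forall>y\<in>C. blinfun_apply x' (y - x) \<le> 0)"
  by (simp add: normal_cone_def)

text \<open>The point \<open>a\<close> is an Ekeland point of the distance to \<open>x\<close> with slope \<open>1/2\<close>, and \<open>v\<close> is a
  multiplier for the resulting convex minimization.\<close>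

lemma normal_vector_separating:
  fixes D :: "'a::banach set"
  assumes D: "closed D" "convex D" "D \<noteq> {}" and x: "x \<notin> D"
  obtains a and v :: "'a dual" where "(a, v) \<in> normal_cone D" "blinfun_apply v (x - a) > 0"
proof -
  have "bdd_below ((\<lambda>y. dist y x) ` D)" "continuous_on D (\<lambda>y. dist y x)"
    by (auto intro: bdd_belowI2[of _ 0] continuous_intros)
  then obtain a where a: "a \<in> D" "\<And>y. y \<in> D \<Longrightarrow> dist a x \<le> dist y x + 1/2 * dist y a"
    using Ekeland[OF D(1,3), of "\<lambda>y. dist y x" "1/2"] by auto
  \<comment> \<open>By the choice of \<open>a\<close>, \<phi> is nonnegative on \<open>D\<close> and
    zero at \<open>a\<close>, while the slope 1/2 below 1 makes it negative at \<open>x\<close>. In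
    \<open>G\<close> the constraint is perturbed by \<open>w\<close>.\<close>
  define \<phi> where "\<phi> y = norm (y - x) + 1/2 * norm (y - a) - norm (a - x)" for y
  define G where "G = {(y, w, r). w + y \<in> D \<and> \<phi> y \<le> r}"
  have G_eq: "G = (\<lambda>g. fst (snd g) + fst g) -` D \<inter> {g. \<phi> (fst g) \<le> snd (snd g)}"
    by (auto simp: G_def)
  have \<phi>_conv: "convex_on UNIV \<phi>"
  proof (rule convex_onI)
    fix t :: real and y z :: 'a assume t: "0 < t" "t < 1"
    define p where "p = (1 - t) *\<^sub>R y + t *\<^sub>R z"
    have *: "norm (p - b) \<le> (1 - t) * norm (y - b) + t * norm (z - b)" for b
    proof -
      have "p - b = (1 - t) *\<^sub>R (y - b) + t *\<^sub>R (z - b)"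
        by (simp add: p_def algebra_simps)
      then show ?thesis
        using norm_triangle_ineq[of "(1 - t) *\<^sub>R (y - b)" "t *\<^sub>R (z - b)"] t by simp
    qed
    have "\<phi> p \<le> (1 - t) * \<phi> y + t * \<phi> z"
      using *[of x] *[of a] by (simp add: \<phi>_def field_simps)
    then show "\<phi> ((1 - t) *\<^sub>R y + t *\<^sub>R z) \<le> (1 - t) * \<phi> y + t * \<phi> z"
      by (simp add: p_def)
  qed auto
  have "closed G"
    unfolding G_eq \<phi>_def
    by (intro closed_Int continuous_closed_vimage D closed_Collect_le continuous_intros)
  moreover have "convex G"
  proof (rule convexI)
    fix g h :: "'a \<times> 'a \<times> real" and p q :: real
    assume gh: "g \<in> G" "h \<in> G" and pq: "0 \<le> p" "0 \<le> q" "p + q = 1"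
    obtain y w r z u s where g: "g = (y, w, r)" and h: "h = (z, u, s)"
      by (metis prod.collapse)
    have "p *\<^sub>R (w + y) + q *\<^sub>R (u + z) \<in> D"
      using gh pq g h by (intro convexD[OF D(2)]) (auto simp: G_def)
    moreover have "\<phi> (p *\<^sub>R y + q *\<^sub>R z) \<le> p * \<phi> y + q * \<phi> z"
      using \<phi>_conv pq by (simp add: convex_on_def)
    moreover have "p * \<phi> y + q * \<phi> z \<le> p * r + q * s"
      using gh pq g h by (intro add_mono mult_left_mono) (auto simp: G_def)
    ultimately show "p *\<^sub>R g + q *\<^sub>R h \<in> G"
      by (simp add: g h G_def algebra_simps)
  qed
  moreover have "0 \<le> r" if "(c, 0, r) \<in> G" for c r
    using that a(2)[of c] by (auto simp: G_def \<phi>_def dist_norm)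
  moreover have "\<exists>t>0. \<exists>c r. (c, t *\<^sub>R e, r) \<in> G" for e
  proof -
    have "(a - e, 1 *\<^sub>R e, \<phi> (a - e)) \<in> G"
      using a(1) by (simp add: G_def)
    then show ?thesis
      using zero_less_one by blast
  qed
  ultimately obtain v :: "'a dual" where v: "\<And>c w r. (c, w, r) \<in> G \<Longrightarrow> v w \<le> r"
    using Lagrange_multiplier[OF _ _ closed_UNIV subspace_UNIV, of G] by (metis UNIV_I)
  show ?thesis
  proof
    show "(a, v) \<in> normal_cone D"
      unfolding mem_normal_cone_iff
    proof (intro conjI ballI a(1))
      fix y assume "y \<in> D"
      then have "(a, y - a, 0) \<in> G"
        by (simp add: G_def \<phi>_def)
      then show "v (y - a) \<le> 0"
        by (rule v)
    qed
    have "(x, a - x, \<phi> x) \<in> G"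
      using a(1) by (simp add: G_def)
    then have "v (a - x) \<le> \<phi> x"
      by (rule v)
    moreover have "\<phi> x < 0"
      using x a(1) by (auto simp: \<phi>_def norm_minus_commute)
    ultimately show "v (x - a) > 0"
      by (simp add: blinfun.diff_right)
  qed
qed

section \<open>Monotone operators\<close>

lemma pairing_Pair [simp]: "pairing (x, x') = blinfun_apply x' x"
  by (simp add: pairing_def)

lemma dual_prod_Pair [simp]:
  "dual_prod (x, x') (y, y') = blinfun_apply x' y + blinfun_apply y' x"
  by (simp add: dual_prod_def)

lemma pairing_diff: "pairing (z - w) = pairing z - dual_prod z w + pairing w"
  by (simp add: pairing_def dual_prod_def blinfun.diff_left blinfun.diff_right)

lemma pairing_minus: "pairing (- z) = pairing z"
  by (simp add: pairing_def blinfun.minus_left blinfun.minus_right)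

lemma mem_dom_op_iff: "x \<in> dom_op A \<longleftrightarrow> (\<exists>x'. (x, x') \<in> A)"
  by (auto simp: dom_op_def values_at_def)

lemma mem_pullback_op_iff:
  "(x, x') \<in> pullback_op L S \<longleftrightarrow> (\<exists>v. (blinfun_apply L x, v) \<in> S \<and> x' = adjoint_blinfun L v)"
  by (auto simp: pullback_op_def values_at_def)

lemma adjoint_blinfun_apply [simp]: "adjoint_blinfun L v x = v (L x)"
  by (simp add: adjoint_blinfun_def)

lemma mem_dom_pullback_iff: "x \<in> dom_op (pullback_op L S) \<longleftrightarrow> blinfun_apply L x \<in> dom_op S"
  by (auto simp: mem_dom_op_iff mem_pullback_op_iff)

text \<open>Scaling a vector where \<open>f\<close> is nonzero would exceed any bound. This turns
  one-sided multiplier estimates into \<open>adjoint_blinfun L v = x'\<close>.\<close>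

lemma blinfun_bounded_above_eq_0:
  fixes f :: "'a::real_normed_vector dual"
  assumes "\<And>x. f x \<le> c"
  shows "f = 0"
proof (rule ccontr)
  assume "f \<noteq> 0"
  then obtain x where "f x \<noteq> 0"
    by (metis blinfun_eqI zero_blinfun.rep_eq)
  then have "f (((\<bar>c\<bar> + 1) / f x) *\<^sub>R x) = \<bar>c\<bar> + 1"
    by (simp add: blinfun.scaleR_right)
  then show False
    using assms[of "((\<bar>c\<bar> + 1) / f x) *\<^sub>R x"] by simp
qed

lemma maximal_monotone_memI:
  assumes "maximal_monotone M" and z: "\<And>a. a \<in> M \<Longrightarrow> 0 \<le> pairing (z - a)"
  shows "z \<in> M"
proof -
  have "0 \<le> pairing (a - z)" if "a \<in> M" for a
    using z[OF that] pairing_minus[of "z - a"] by simp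
  moreover have "pairing (0 :: 'a \<times> 'a dual) = 0"
    by (simp add: pairing_def)
  ultimately have "monotone_op (insert z M)"
    using assms by (auto simp: maximal_monotone_def monotone_op_def)
  then have "insert z M = M"
    using assms(1) unfolding maximal_monotone_def by blast
  then show ?thesis
    by blast
qed

lemma maximal_monotoneI:
  assumes "monotone_op A" and "\<And>z. (\<And>a. a \<in> A \<Longrightarrow> 0 \<le> pairing (z - a)) \<Longrightarrow> z \<in> A"
  shows "maximal_monotone A"
  unfolding maximal_monotone_def
proof (intro conjI allI impI assms(1) equalityI)
  fix B assume "monotone_op B" "A \<subseteq> B"
  then show "B \<subseteq> A"
    using assms(2) unfolding monotone_op_def by blast
qed

lemma maximal_monotone_nonempty:
  assumes "maximal_monotone M"
  shows "M \<noteq> {}"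
  using maximal_monotone_memI[OF assms, of 0] by blast

lemma monotone_dual_prod_le:
  assumes "monotone_op M" "z \<in> M" "a \<in> M"
  shows "dual_prod z a - pairing a \<le> pairing z"
proof -
  have "0 \<le> pairing (z - a)"
    using assms unfolding monotone_op_def by blast
  then show ?thesis
    by (simp add: pairing_diff)
qed

text \<open>A smaller bound \<open>c\<close> would force \<open>z\<close> into \<open>M\<close>, and
  then \<open>a = z\<close> gives the contradiction. Real upper bounds stand for the extended-real
  supremum.\<close>

lemma maximal_monotone_fitzpatrick_ge:
  assumes M: "maximal_monotone M" and c: "\<And>a. a \<in> M \<Longrightarrow> dual_prod z a - pairing a \<le> c"
  shows "pairing z \<le> c"
proof (rule ccontr)
  assume less: "\<not> ?thesis"
  have "0 \<le> pairing (z - a)" if "a \<in> M" for a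
    using c[OF that] less by (simp add: pairing_diff)
  then have "z \<in> M"
    by (rule maximal_monotone_memI[OF M])
  then show False
    using c[of z] less by (simp add: dual_prod_def pairing_def)
qed

text \<open>Adding \<open>n\<close> changes the pairing with each element of \<open>M\<close> by
  \<open>n (y - u) \<ge> 0\<close>, so maximality applies.\<close>

lemma maximal_monotone_add_normal:
  assumes M: "maximal_monotone M" and "(y, y') \<in> M" "(y, n) \<in> normal_cone (dom_op M)"
  shows "(y, y' + n) \<in> M"
proof (rule maximal_monotone_memI[OF M])
  fix a assume a: "a \<in> M"
  obtain u u' where u: "a = (u, u')"
    by fastforce
  have "0 \<le> pairing ((y, y') - a)"
    using M assms(2) a unfolding maximal_monotone_def monotone_op_def by blast
  moreover have "n (u - y) \<le> 0"
    using assms(3) a by (auto simp: u mem_normal_cone_iff mem_dom_op_iff)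
  ultimately show "0 \<le> pairing ((y, y' + n) - a)"
    by (simp add: u pairing_def blinfun.bilinear_simps)
qed

lemma monotone_pullback_op:
  assumes "monotone_op M"
  shows "monotone_op (pullback_op L M)"
  unfolding monotone_op_def
proof (intro ballI)
  fix a b assume "a \<in> pullback_op L M" "b \<in> pullback_op L M"
  then obtain x v y w where a: "a = (x, adjoint_blinfun L v)" "(L x, v) \<in> M"
    and b: "b = (y, adjoint_blinfun L w)" "(L y, w) \<in> M"
    by (metis mem_pullback_op_iff surj_pair)
  then have "0 \<le> pairing ((L x, v) - (L y, w))"
    using assms unfolding monotone_op_def by blast
  then show "0 \<le> pairing (a - b)"
    by (simp add: a b pairing_def blinfun.bilinear_simps)
qed

text \<open>Off the closed convex domain there is a normal vector pointing towards \<open>z\<close>; adding large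
  multiples of it to an element of \<open>A\<close> would violate the monotone relation.\<close>

lemma monotonically_related_dom:
  fixes A :: "('a::banach, 'a dual) operator"
  assumes dom: "closed (dom_op A)" "convex (dom_op A)" "dom_op A \<noteq> {}"
    and add: "\<And>x x' n. (x, x') \<in> A \<Longrightarrow> (x, n) \<in> normal_cone (dom_op A) \<Longrightarrow> (x, x' + n) \<in> A"
    and z: "\<And>a. a \<in> A \<Longrightarrow> 0 \<le> pairing (z - a)"
  shows "fst z \<in> dom_op A"
proof (rule ccontr)
  assume "fst z \<notin> dom_op A"
  then obtain a and n :: "'a dual"
    where n: "(a, n) \<in> normal_cone (dom_op A)" "n (fst z - a) > 0"
    using normal_vector_separating[OF dom] by metis
  obtain a' where a': "(a, a') \<in> A"
    using n(1) by (auto simp: mem_normal_cone_iff mem_dom_op_iff)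
  define q where "q = pairing (z - (a, a'))"
  define t where "t = (q + 1) / n (fst z - a)"
  have "q \<ge> 0"
    using z[OF a'] by (simp add: q_def)
  then have "t \<ge> 0"
    using n(2) by (simp add: t_def)
  then have "(a, t *\<^sub>R n) \<in> normal_cone (dom_op A)"
    using n(1) by (auto simp: mem_normal_cone_iff blinfun.scaleR_left mult_nonneg_nonpos)
  then have "0 \<le> pairing (z - (a, a' + t *\<^sub>R n))"
    using add[OF a'] z by blast
  also have "\<dots> = q - t * n (fst z - a)"
    by (simp add: q_def pairing_def blinfun.bilinear_simps right_diff_distrib)
  also have "\<dots> = - 1"
    using n(2) by (simp add: t_def)
  finally show False
    by simp
qed

text \<open>Otherwise \<open>pairing (z - a)\<close> is positive on \<open>A\<close>, so
  \<open>fst z\<close> lies in the domain; but the pairing vanishes when \<open>a\<close> has the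
  same first component as \<open>z\<close>.\<close>

lemma fitzpatrick_ge_of_normal:
  fixes A :: "('a::banach, 'a dual) operator"
  assumes "closed (dom_op A)" "convex (dom_op A)" "dom_op A \<noteq> {}"
    and "\<And>x x' n. (x, x') \<in> A \<Longrightarrow> (x, n) \<in> normal_cone (dom_op A) \<Longrightarrow> (x, x' + n) \<in> A"
    and c: "\<And>a. a \<in> A \<Longrightarrow> dual_prod z a - pairing a \<le> c"
  shows "pairing z \<le> c"
proof (rule ccontr)
  assume less: "\<not> ?thesis"
  have pos: "0 < pairing (z - a)" if "a \<in> A" for a
    using c[OF that] less by (simp add: pairing_diff)
  then have "fst z \<in> dom_op A"
    by (intro monotonically_related_dom assms) (auto intro: less_imp_le)
  then obtain z' where "(fst z, z') \<in> A"
    by (auto simp: mem_dom_op_iff)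
  from pos[OF this] show False
    by (simp add: pairing_def)
qed

lemma NI_typeI:
  assumes "A \<noteq> {}"
    and "\<And>z c. (\<And>a. a \<in> A \<Longrightarrow> dual_prod z a - pairing a \<le> c) \<Longrightarrow> pairing z \<le> c"
  shows "NI_type A"
  unfolding NI_type_def
proof (intro conjI allI assms(1))
  fix z
  show "ereal (pairing z) \<le> fitzpatrick A z"
  proof (rule ccontr)
    assume "\<not> ?thesis"
    then obtain c where c: "fitzpatrick A z < ereal c" "ereal c < ereal (pairing z)"
      using ereal_dense2 by (metis not_le)
    have "dual_prod z a - pairing a \<le> c" if "a \<in> A" for a
    proof -
      have "ereal (dual_prod z a - pairing a) \<le> fitzpatrick A z"
        unfolding fitzpatrick_def by (rule SUP_upper[OF that])
      then show ?thesis
        using c(1) by (metis ereal_less_eq(3) le_less_trans less_imp_le)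
    qed
    then have "pairing z \<le> c"
      by (rule assms(2))
    then show False
      using c(2) by simp
  qed
qed

text \<open>A normal vector of D(T) lifts through the adjoint to one of D(M), where it can be added
  to \<open>M\<close>.\<close>

lemma pullback_add_normal:
  assumes M: "maximal_monotone M"
    and N: "normal_cone (dom_op (pullback_op L M)) \<subseteq> pullback_op L (normal_cone (dom_op M))"
    and x: "(x, x') \<in> pullback_op L M" and n: "(x, n) \<in> normal_cone (dom_op (pullback_op L M))"
  shows "(x, x' + n) \<in> pullback_op L M"
proof -
  obtain v w where v: "(L x, v) \<in> M" "x' = adjoint_blinfun L v"
    and w: "(L x, w) \<in> normal_cone (dom_op M)" "n = adjoint_blinfun L w"
    using x n N by (meson mem_pullback_op_iff subsetD)
  have "x' + n = adjoint_blinfun L (v + w)"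
    by (rule blinfun_eqI) (simp add: v w blinfun.add_left)
  then show ?thesis
    using maximal_monotone_add_normal[OF M v(1) w(1)] by (auto simp: mem_pullback_op_iff)
qed

text \<open>A point where the Fitzpatrick function touches the pairing from above: there the derivative
  of the pairing is a subgradient of the Fitzpatrick function.\<close>

lemma fitzpatrick_subgradient:
  assumes ge: "\<And>z c. (\<And>a. a \<in> A \<Longrightarrow> dual_prod z a - pairing a \<le> c) \<Longrightarrow> pairing z \<le> c"
    and z: "\<And>a. a \<in> A \<Longrightarrow> 0 \<le> pairing (z - a)"
    and w: "\<And>a. a \<in> A \<Longrightarrow> dual_prod w a - pairing a \<le> c"
  shows "dual_prod z w - pairing z \<le> c"
proof (rule ccontr)
  define b where "b = dual_prod z w - pairing z"
  assume "\<not> ?thesis"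
  then have cb: "c < b"
    by (simp add: b_def)
  \<comment> \<open>The upper bound is convex along the segment from \<open>z\<close> to
    \<open>w\<close>, and \<open>ge\<close> holds on it; expanding the quadratic pairing and
    dividing by \<open>t\<close> leaves this inequality.\<close>
  have le: "(1 - t) * b + t * pairing w \<le> c" if t: "0 < t" "t < 1" for t
  proof -
    have "pairing ((1 - t) *\<^sub>R z + t *\<^sub>R w) \<le> (1 - t) * pairing z + t * c"
    proof (rule ge)
      fix a assume a: "a \<in> A"
      have "(1 - t) * (dual_prod z a - pairing a) \<le> (1 - t) * pairing z"
        using z[OF a] t by (intro mult_left_mono) (simp_all add: pairing_diff)
      moreover have "t * (dual_prod w a - pairing a) \<le> t * c"
        using w[OF a] t by (intro mult_left_mono) simp_all
      moreover have "dual_prod ((1 - t) *\<^sub>R z + t *\<^sub>R w) a - pairing a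
          = (1 - t) * (dual_prod z a - pairing a) + t * (dual_prod w a - pairing a)"
        by (simp add: dual_prod_def blinfun.bilinear_simps algebra_simps)
      ultimately show "dual_prod ((1 - t) *\<^sub>R z + t *\<^sub>R w) a - pairing a
          \<le> (1 - t) * pairing z + t * c"
        by linarith
    qed
    moreover have "pairing ((1 - t) *\<^sub>R z + t *\<^sub>R w)
        = (1 - t) * pairing z + t * ((1 - t) * b + t * pairing w)"
      by (simp add: b_def pairing_def dual_prod_def blinfun.bilinear_simps algebra_simps)
    ultimately show ?thesis
      using t by simp
  qed
  \<comment> \<open>The inequality \<open>le\<close> says
    \<open>b - c \<le> t * (b - pairing w)\<close>. Since \<open>m\<close> exceeds the last factor,
    \<open>t = (b - c) / m\<close> violates it; the other summands of \<open>m\<close> keep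
    \<open>t\<close> in (0, 1).\<close>
  define m where "m = b - c + \<bar>b - pairing w\<bar> + 1"
  define t where "t = (b - c) / m"
  have m: "m > 0" "b - c < m"
    using cb by (simp_all add: m_def)
  then have t: "0 < t" "t < 1"
    using cb by (simp_all add: t_def)
  have "t * m = b - c"
    using m by (simp add: t_def)
  moreover have "t * (b - pairing w) < t * m"
    using t(1) cb by (intro mult_strict_left_mono) (auto simp: m_def)
  ultimately show False
    using le[OF t] by (simp add: algebra_simps)
qed

section \<open>Maximality of the composition\<close>

text \<open>A Fenchel-type duality: \<open>fitz\<close> bounds the Fitzpatrick function of
  \<open>M\<close> below along \<open>y0\<close> plus the range of \<open>L\<close>, and
  \<open>v\<close> is the multiplier for perturbing its first argument by \<open>w\<close>. It is
  tested at points of \<open>M\<close>, where this function is at most the pairing.\<close>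

lemma maximal_monotone_dual_point:
  fixes M :: "('b::banach, 'b dual) operator" and L :: "'a::banach \<Rightarrow>\<^sub>L 'b" and x' :: "'a dual"
  assumes M: "maximal_monotone M" and E: "closed E" "subspace E"
    and fitz: "\<And>x y' r. (\<And>a. a \<in> M \<Longrightarrow> dual_prod (y0 + L x, y') a - pairing a \<le> r)
        \<Longrightarrow> y' y0 + x' x \<le> r"
    and sub: "\<And>x y. y \<in> dom_op M \<Longrightarrow> y - y0 - L x \<in> E"
    and abs: "\<And>e. e \<in> E \<Longrightarrow> \<exists>t>0. \<exists>x y' r. \<forall>a\<in>M.
        dual_prod (y0 + L x + t *\<^sub>R e, y') a - pairing a \<le> r"
  obtains v where "adjoint_blinfun L v = x'" "(y0, v) \<in> M"
proof -
  define G where "G = {((x, y'), w, r). \<forall>a\<in>M.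
    dual_prod (y0 + L x + w, y') a - pairing a \<le> r + y' y0 + x' x}"
  \<comment> \<open>Linear in \<open>g\<close>, so that \<open>G\<close> becomes an intersection of
    closed half-spaces.\<close>
  define l :: "'b \<times> 'b dual \<Rightarrow> ('a \<times> 'b dual) \<times> 'b \<times> real \<Rightarrow> real" where
    "l a g = snd a (L (fst (fst g)) + fst (snd g)) + snd (fst g) (fst a - y0)
      - snd (snd g) - x' (fst (fst g))" for a g
  have G_eq: "G = (\<Inter>a\<in>M. {g. l a g \<le> pairing a - snd a y0})"
    by (fastforce simp: G_def l_def dual_prod_def pairing_def blinfun.bilinear_simps algebra_simps)
  have "linear (l a)" for a
    by (rule linearI) (simp_all add: l_def blinfun.bilinear_simps algebra_simps)
  then have "convex {g. l a g \<le> c}" for a c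
    using convex_linear_vimage[of "l a" "{..c}"] by (simp add: vimage_def)
  then have "convex G"
    unfolding G_eq by (intro convex_INT) auto
  moreover have "closed G"
    unfolding G_eq l_def by (intro closed_INT ballI closed_Collect_le continuous_intros)
  moreover have "0 \<le> r" if "(g, 0, r) \<in> G" for g r
  proof -
    obtain x y' where "g = (x, y')"
      by fastforce
    then show ?thesis
      using fitz[of x y' "r + y' y0 + x' x"] that by (simp add: G_def)
  qed
  moreover have "\<exists>t>0. \<exists>g r. (g, t *\<^sub>R e, r) \<in> G" if e: "e \<in> E" for e
  proof -
    obtain t x y' r where t: "t > 0"
      and r: "\<forall>a\<in>M. dual_prod (y0 + L x + t *\<^sub>R e, y') a - pairing a \<le> r"
      using abs[OF e] by blast
    have "((x, y'), t *\<^sub>R e, r - y' y0 - x' x) \<in> G"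
      using r by (simp add: G_def)
    then show ?thesis
      using t by blast
  qed
  ultimately obtain v :: "'b dual"
    where v: "\<And>g w r. (g, w, r) \<in> G \<Longrightarrow> w \<in> E \<Longrightarrow> v w \<le> r"
    using Lagrange_multiplier[of G E] E by blast
  have ineq: "v (y - y0 - L x) \<le> y' y - y' y0 - x' x" if y: "(y, y') \<in> M" for x y y'
  proof (rule v)
    have "dual_prod (y, y') a - pairing a \<le> y' y" if "a \<in> M" for a
      using monotone_dual_prod_le[OF _ y that] M by (simp add: maximal_monotone_def)
    then show "((x, y'), y - y0 - L x, y' y - y' y0 - x' x) \<in> G"
      by (simp add: G_def)
    show "y - y0 - L x \<in> E"
      using sub y by (auto simp: mem_dom_op_iff)
  qed
  obtain y y' where y: "(y, y') \<in> M"
    using maximal_monotone_nonempty[OF M] by fastforce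
  \<comment> \<open>The right-hand side is constant in \<open>x\<close>, so the functional on the
    left is bounded above.\<close>
  have "(x' - adjoint_blinfun L v) x \<le> y' y - y' y0 - v (y - y0)" for x
    using ineq[OF y, of x] by (simp add: blinfun.bilinear_simps)
  then have "x' - adjoint_blinfun L v = 0"
    by (rule blinfun_bounded_above_eq_0)
  moreover have "(y0, v) \<in> M"
  proof (rule maximal_monotone_memI[OF M])
    fix a assume "a \<in> M"
    then show "0 \<le> pairing ((y0, v) - a)"
      using ineq[of "fst a" "snd a" 0] by (simp add: pairing_def blinfun.bilinear_simps)
  qed
  ultimately show ?thesis
    using that by simp
qed

text \<open>\<open>v\<close> is the multiplier for shifting the constraint
  \<open>y0 + L u \<in> K\<close> by \<open>w\<close> in the bound \<open>x' u \<le> 0\<close>. The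
  larger set \<open>K\<close> supplies closedness and convexity; normality is tested on
  \<open>D\<close>.\<close>

lemma normal_vector_preimage:
  fixes K :: "'b::banach set" and L :: "'a::banach \<Rightarrow>\<^sub>L 'b" and x' :: "'a dual"
  assumes K: "closed K" "convex K" and D: "D \<subseteq> K" "D \<noteq> {}" and E: "closed E" "subspace E"
    and nonpos: "\<And>u. y0 + L u \<in> K \<Longrightarrow> x' u \<le> 0"
    and sub: "\<And>u y. y \<in> D \<Longrightarrow> y - y0 - L u \<in> E"
    and abs: "\<And>e. e \<in> E \<Longrightarrow> \<exists>t>0. \<exists>u. y0 + L u + t *\<^sub>R e \<in> K"
  obtains v where "adjoint_blinfun L v = x'" "\<And>y. y \<in> D \<Longrightarrow> blinfun_apply v (y - y0) \<le> 0"
proof -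
  define G where "G = {(u, w, r). y0 + (L u + w) \<in> K \<and> - x' u \<le> r}"
  have G_eq: "G = (\<lambda>g. y0 + (L (fst g) + fst (snd g))) -` K \<inter> {g. - x' (fst g) \<le> snd (snd g)}"
    by (auto simp: G_def)
  have "closed G"
    unfolding G_eq
    by (intro closed_Int continuous_closed_vimage K closed_Collect_le continuous_intros)
  moreover have "convex G"
  proof (rule convexI)
    fix g h :: "'a \<times> 'b \<times> real" and p q :: real
    assume gh: "g \<in> G" "h \<in> G" and pq: "0 \<le> p" "0 \<le> q" "p + q = 1"
    obtain u w r z s k where g: "g = (u, w, r)" and h: "h = (z, s, k)"
      by (metis prod.collapse)
    have "p *\<^sub>R (y0 + (L u + w)) + q *\<^sub>R (y0 + (L z + s)) \<in> K"
      using gh pq g h by (intro convexD[OF K(2)]) (auto simp: G_def)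
    moreover have "p *\<^sub>R (y0 + (L u + w)) + q *\<^sub>R (y0 + (L z + s))
        = y0 + (L (p *\<^sub>R u + q *\<^sub>R z) + (p *\<^sub>R w + q *\<^sub>R s))"
    proof -
      have "p *\<^sub>R y0 + q *\<^sub>R y0 = y0"
        using pq(3) by (simp flip: scaleR_add_left)
      then show ?thesis
        by (simp add: blinfun.bilinear_simps scaleR_add_right add_ac)
    qed
    moreover have "p * (- x' u) + q * (- x' z) \<le> p * r + q * k"
      using gh pq g h by (intro add_mono mult_left_mono) (auto simp: G_def)
    ultimately show "p *\<^sub>R g + q *\<^sub>R h \<in> G"
      by (simp add: g h G_def blinfun.bilinear_simps)
  qed
  moreover have "0 \<le> r" if "(u, 0, r) \<in> G" for u r
    using that nonpos[of u] by (simp add: G_def)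
  moreover have "\<exists>t>0. \<exists>u r. (u, t *\<^sub>R e, r) \<in> G" if e: "e \<in> E" for e
  proof -
    obtain t u where t: "t > 0" "y0 + L u + t *\<^sub>R e \<in> K"
      using abs[OF e] by blast
    then have "(u, t *\<^sub>R e, - x' u) \<in> G"
      by (simp add: G_def add.assoc)
    then show ?thesis
      using t by blast
  qed
  ultimately obtain v :: "'b dual"
    where v: "\<And>u w r. (u, w, r) \<in> G \<Longrightarrow> w \<in> E \<Longrightarrow> v w \<le> r"
    using Lagrange_multiplier[of G E] E by blast
  have ineq: "v (y - y0 - L u) \<le> - x' u" if y: "y \<in> D" for y u
  proof (rule v)
    show "(u, y - y0 - L u, - x' u) \<in> G"
      using y D by (auto simp: G_def)
  qed (rule sub[OF y])
  obtain y where y: "y \<in> D"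
    using D by blast
  have "(x' - adjoint_blinfun L v) u \<le> - v (y - y0)" for u
    using ineq[OF y, of u] by (simp add: blinfun.bilinear_simps)
  then have "x' - adjoint_blinfun L v = 0"
    by (rule blinfun_bounded_above_eq_0)
  moreover have "v (y - y0) \<le> 0" if "y \<in> D" for y
    using ineq[OF that, of 0] by (simp add: blinfun.bilinear_simps)
  ultimately show ?thesis
    using that by simp
qed

section \<open>Interiority conditions on R(L) - D(M)\<close>

lemma ic_interior_range_diff:
  fixes L :: "'a::real_normed_vector \<Rightarrow>\<^sub>L 'b::real_normed_vector"
  assumes ic: "0 \<in> ic_interior (set_diff_alg (range L) D)"
  obtains E where "closed E" "subspace E"
    "\<And>x y. y \<in> D \<Longrightarrow> y - L x \<in> E"
    "\<And>e. e \<in> E \<Longrightarrow> \<exists>t>0. \<exists>x. L x + t *\<^sub>R e \<in> D"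
proof -
  define S where "S = set_diff_alg (range L) D"
  define E where "E = affine hull S"
  have clE: "closed E" and core: "0 \<in> rel_alg_interior S"
    using ic by (auto simp: ic_interior_def S_def E_def split: if_splits)
  have S0: "0 \<in> S" and core': "\<And>y. y \<in> E \<Longrightarrow> \<exists>\<delta>>0. \<forall>t\<in>{0..\<delta>}. t *\<^sub>R y \<in> S"
    using core by (auto simp: rel_alg_interior_def E_def)
  have SE: "S \<subseteq> E"
    by (simp add: E_def hull_subset)
  have E: "subspace E"
    using SE S0 by (auto simp: subspace_affine E_def)
  show ?thesis
  proof (rule that[OF clE E])
    fix x y assume "y \<in> D"
    then have "L x - y \<in> S"
      by (auto simp: S_def set_diff_alg_def)
    then have "L x - y \<in> E"
      using SE by blast
    then show "y - L x \<in> E"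
      using subspace_neg[OF E] by fastforce
  next
    \<comment> \<open>Elements of \<open>S\<close> have the form \<open>L x - y\<close>, so the core
      property is needed in the direction \<open>- e\<close>.\<close>
    fix e assume "e \<in> E"
    then have "- e \<in> E"
      using subspace_neg[OF E] by blast
    then obtain \<delta> where \<delta>: "\<delta> > 0" "\<forall>t\<in>{0..\<delta>}. t *\<^sub>R (- e) \<in> S"
      using core' by blast
    then have "\<delta> *\<^sub>R (- e) \<in> S"
      by (meson atLeastAtMost_iff less_imp_le order_refl)
    then obtain x y where "\<delta> *\<^sub>R (- e) = L x - y" "y \<in> D"
      by (auto simp: S_def set_diff_alg_def)
    then have "L x + \<delta> *\<^sub>R e \<in> D"
      by (simp add: algebra_simps)
    then show "\<exists>t>0. \<exists>x. L x + t *\<^sub>R e \<in> D"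
      using \<delta>(1) by blast
  qed
qed

text \<open>A ball around 0 makes the affine hull the whole space. This reduces the interior
  condition of (\<gamma>) to that of (\<beta>).\<close>

lemma zero_in_ic_interior:
  fixes S :: "'b::real_normed_vector set"
  assumes "0 \<in> interior S"
  shows "0 \<in> ic_interior S"
proof -
  obtain d where d: "d > 0" "ball 0 d \<subseteq> S"
    using assms by (auto simp: mem_interior)
  have scaled: "t *\<^sub>R y \<in> S" if "0 \<le> t" "t \<le> d / (norm y + 1)" for t y
  proof -
    have "t * norm y \<le> d / (norm y + 1) * norm y"
      using that by (intro mult_right_mono) auto
    also have "\<dots> < d"
      using d(1) by (simp add: field_simps add_pos_nonneg)
    finally show ?thesis
      using d(2) that(1) by auto
  qed
  have pos: "d / (norm y + 1) > 0" for y :: 'b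
    using d(1) by (simp add: add_nonneg_pos)
  have S0: "0 \<in> S"
    using d by auto
  then have sub: "subspace (affine hull S)"
    by (simp add: subspace_affine hull_inc)
  have "y \<in> affine hull S" for y
  proof -
    define t where "t = d / (norm y + 1)"
    have "t *\<^sub>R y \<in> affine hull S" "t > 0"
      using scaled[of t y] pos[of y] by (auto simp: t_def hull_inc)
    then show ?thesis
      using subspace_scale[OF sub, of "t *\<^sub>R y" "1 / t"] by simp
  qed
  then have hull: "affine hull S = UNIV"
    by blast
  have "\<exists>\<delta>>0. \<forall>t\<in>{0..\<delta>}. t *\<^sub>R y \<in> S" for y
    using scaled pos[of y] by (intro exI[of _ "d / (norm y + 1)"]) auto
  then show ?thesis
    using S0 by (simp add: ic_interior_def rel_alg_interior_def hull)
qed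

text \<open>The common core of (\<beta>) and (\<gamma>). \<open>K\<close> has the same preimage
  under \<open>L\<close> as D(M), which makes D(T) closed and convex even where D(M) is not.\<close>

lemma maximal_monotone_pullback_op:
  fixes M :: "('b::banach, 'b dual) operator" and L :: "'a::banach \<Rightarrow>\<^sub>L 'b"
  assumes M: "maximal_monotone M"
    and K: "closed K" "convex K" "dom_op M \<subseteq> K" "\<And>x. L x \<in> K \<Longrightarrow> L x \<in> dom_op M"
    and ic: "0 \<in> ic_interior (set_diff_alg (range L) (dom_op M))"
  shows "maximal_monotone (pullback_op L M)"
proof -
  define T where "T = pullback_op L M"
  obtain E where E: "closed E" "subspace E"
    and sub: "\<And>x y. y \<in> dom_op M \<Longrightarrow> y - L x \<in> E"
    and abs: "\<And>e. e \<in> E \<Longrightarrow> \<exists>t>0. \<exists>x. L x + t *\<^sub>R e \<in> dom_op M"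
    using ic_interior_range_diff[OF ic] by metis
  have sub': "y - L x0 - L x \<in> E" if "y \<in> dom_op M" for x0 x y
    using sub[OF that, of "x0 + x"] by (simp add: blinfun.add_right algebra_simps)
  have abs': "\<exists>t>0. \<exists>x. L x0 + L x + t *\<^sub>R e \<in> dom_op M" if e: "e \<in> E" for x0 e
  proof -
    obtain t x where "t > 0" "L x + t *\<^sub>R e \<in> dom_op M"
      using abs[OF e] by blast
    then have "t > 0" "L x0 + L (x - x0) + t *\<^sub>R e \<in> dom_op M"
      by (simp_all add: blinfun.diff_right)
    then show ?thesis
      by blast
  qed
  have dom: "dom_op T = L -` K"
    using K(3,4) by (auto simp: T_def mem_dom_pullback_iff)
  have closed: "closed (dom_op T)"
    unfolding dom by (intro continuous_closed_vimage K continuous_intros)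
  have convex: "convex (dom_op T)"
    unfolding dom
    by (rule convex_linear_vimage[OF _ K(2)]) (simp add: blinfun.bounded_linear_right bounded_linear.linear)
  obtain x1 where x1: "L x1 \<in> dom_op M"
    using abs[OF subspace_0[OF E(2)]] by auto
  then have ne: "dom_op T \<noteq> {}"
    by (auto simp: T_def mem_dom_pullback_iff)
  have N: "normal_cone (dom_op T) \<subseteq> pullback_op L (normal_cone (dom_op M))"
  proof
    fix z assume z: "z \<in> normal_cone (dom_op T)"
    obtain x x' where z_eq: "z = (x, x')"
      by fastforce
    have x: "L x \<in> dom_op M" and x': "\<And>u. u \<in> dom_op T \<Longrightarrow> x' (u - x) \<le> 0"
      using z by (auto simp: z_eq mem_normal_cone_iff T_def mem_dom_pullback_iff)
    obtain v where "adjoint_blinfun L v = x'" "\<And>y. y \<in> dom_op M \<Longrightarrow> v (y - L x) \<le> 0"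
    proof (rule normal_vector_preimage[OF K(1-3) _ E])
      show "dom_op M \<noteq> {}"
        using x by blast
      show "x' u \<le> 0" if "L x + L u \<in> K" for u
        using x'[of "x + u"] that by (simp add: dom blinfun.add_right)
      show "y - L x - L u \<in> E" if "y \<in> dom_op M" for u y
        by (rule sub'[OF that])
      show "\<exists>t>0. \<exists>u. L x + L u + t *\<^sub>R e \<in> K" if "e \<in> E" for e
        using abs'[OF that] K(3) by blast
    qed blast
    then show "z \<in> pullback_op L (normal_cone (dom_op M))"
      using x by (auto simp: z_eq mem_pullback_op_iff mem_normal_cone_iff)
  qed
  have ge: "pairing z \<le> c" if "\<And>a. a \<in> T \<Longrightarrow> dual_prod z a - pairing a \<le> c" for z c
  proof (rule fitzpatrick_ge_of_normal[OF closed convex ne])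
    show "(x, x' + n) \<in> T" if "(x, x') \<in> T" "(x, n) \<in> normal_cone (dom_op T)" for x x' n
      using pullback_add_normal[OF M] N that unfolding T_def by blast
  qed (rule that)
  have "maximal_monotone T"
  proof (rule maximal_monotoneI)
    show "monotone_op T"
      using M by (simp add: T_def maximal_monotone_def monotone_pullback_op)
    fix z assume z: "\<And>a. a \<in> T \<Longrightarrow> 0 \<le> pairing (z - a)"
    obtain x0 x' where z_eq: "z = (x0, x')"
      by fastforce
    obtain v where "adjoint_blinfun L v = x'" "(L x0, v) \<in> M"
    proof (rule maximal_monotone_dual_point[OF M E])
      show "y - L x0 - L x \<in> E" if "y \<in> dom_op M" for x y
        by (rule sub'[OF that])
    next
      fix e assume "e \<in> E"
      then obtain t x y' where t: "t > 0" and y': "(L x0 + L x + t *\<^sub>R e, y') \<in> M"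
        using abs' unfolding mem_dom_op_iff by blast
      have "monotone_op M"
        using M by (simp add: maximal_monotone_def)
      then show "\<exists>t>0. \<exists>x y' r. \<forall>a\<in>M. dual_prod (L x0 + L x + t *\<^sub>R e, y') a - pairing a \<le> r"
        using t monotone_dual_prod_le[OF _ y'] by blast
    next
      fix x y' r
      assume r: "\<And>a. a \<in> M \<Longrightarrow> dual_prod (L x0 + L x, y') a - pairing a \<le> r"
      \<comment> \<open>The Fitzpatrick function of \<open>T\<close> at this point is at most that
        of \<open>M\<close> at \<open>(L x0 + L x, y')\<close>, so \<open>r\<close> bounds it and
        the subgradient inequality at \<open>z\<close> applies.\<close>
      have "dual_prod z (x0 + x, adjoint_blinfun L y') - pairing z \<le> r"
      proof (rule fitzpatrick_subgradient[OF ge z])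
        fix a assume "a \<in> T"
        then obtain u w where "a = (u, adjoint_blinfun L w)" "(L u, w) \<in> M"
          unfolding T_def by (metis mem_pullback_op_iff surj_pair)
        then show "dual_prod (x0 + x, adjoint_blinfun L y') a - pairing a \<le> r"
          using r[of "(L u, w)"] by (simp add: blinfun.bilinear_simps)
      qed
      then show "y' (L x0) + x' x \<le> r"
        by (simp add: z_eq blinfun.bilinear_simps)
    qed blast
    then show "z \<in> T"
      by (auto simp: z_eq T_def mem_pullback_op_iff)
  qed
  then show ?thesis
    by (simp add: T_def)
qed

section \<open>The effective domain of the Fitzpatrick function and its interior\<close>

lemma in_interior_closure_convex_shrink:
  fixes S :: "'a::real_normed_vector set"
  assumes "convex S" "c \<in> interior S" "x \<in> closure S" "0 < e" "e \<le> 1"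
  shows "(1 - e) *\<^sub>R x + e *\<^sub>R c \<in> interior S"
proof -
  obtain d where d: "d > 0" "ball c d \<subseteq> S"
    using assms(2) by (auto simp: mem_interior)
  define p where "p = (1 - e) *\<^sub>R x + e *\<^sub>R c"
  \<comment> \<open>Replacing \<open>x\<close> by \<open>y\<close> moves the combination by less
    than \<open>e * d\<close>, the radius of the ball in \<open>S\<close> that \<open>c\<close>
    provides around it.\<close>
  obtain y where y: "y \<in> S" "dist y x < e * d"
    using assms(3,4) d(1) closure_approachable by (metis mult_pos_pos)
  have ball: "ball ((1 - e) *\<^sub>R y + e *\<^sub>R c) (e * d) \<subseteq> S"
  proof
    fix w assume w: "w \<in> ball ((1 - e) *\<^sub>R y + e *\<^sub>R c) (e * d)"
    define b where "b = c + (1 / e) *\<^sub>R (w - ((1 - e) *\<^sub>R y + e *\<^sub>R c))"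
    have "dist c b < d"
      using w assms(4) by (simp add: b_def dist_norm norm_minus_commute divide_simps mult.commute)
    then have "(1 - e) *\<^sub>R y + e *\<^sub>R b \<in> S"
      using assms y d by (intro convexD) auto
    moreover have "(1 - e) *\<^sub>R y + e *\<^sub>R b = w"
      using assms(4) by (simp add: b_def scaleR_add_right)
    ultimately show "w \<in> S"
      by simp
  qed
  have "dist ((1 - e) *\<^sub>R y + e *\<^sub>R c) p = (1 - e) * dist y x"
  proof -
    have "(1 - e) *\<^sub>R y + e *\<^sub>R c - p = (1 - e) *\<^sub>R (y - x)"
      by (simp add: p_def scaleR_diff_right)
    then show ?thesis
      using assms(5) by (simp add: dist_norm)
  qed
  also have "\<dots> \<le> 1 * dist y x"
    using assms(4) by (intro mult_right_mono) auto
  finally have "p \<in> ball ((1 - e) *\<^sub>R y + e *\<^sub>R c) (e * d)"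
    using y(2) by simp
  then show ?thesis
    unfolding p_def using ball by (meson interiorI open_ball)
qed

text \<open>The projection of the effective domain of the Fitzpatrick function, with
  \<open>r\<close> witnessing a finite upper bound. It is convex, which D(M) need not be.\<close>

definition fitzpatrick_domain ::
    "('a::real_normed_vector, 'a dual) operator \<Rightarrow> 'a set" where
  "fitzpatrick_domain M = {y. \<exists>y' r. \<forall>a\<in>M. dual_prod (y, y') a - pairing a \<le> r}"

lemma convex_fitzpatrick_domain: "convex (fitzpatrick_domain M)"
proof (rule convexI)
  fix y z and p q :: real
  assume yz: "y \<in> fitzpatrick_domain M" "z \<in> fitzpatrick_domain M"
    and pq: "0 \<le> p" "0 \<le> q" "p + q = 1"
  obtain y' r z' s where
    y: "\<And>a. a \<in> M \<Longrightarrow> dual_prod (y, y') a - pairing a \<le> r" and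
    z: "\<And>a. a \<in> M \<Longrightarrow> dual_prod (z, z') a - pairing a \<le> s"
    using yz unfolding fitzpatrick_domain_def by blast
  have "dual_prod (p *\<^sub>R y + q *\<^sub>R z, p *\<^sub>R y' + q *\<^sub>R z') a - pairing a \<le> p * r + q * s"
    if a: "a \<in> M" for a
  proof -
    have "dual_prod (p *\<^sub>R y + q *\<^sub>R z, p *\<^sub>R y' + q *\<^sub>R z') a - (p + q) * pairing a
        = p * (dual_prod (y, y') a - pairing a) + q * (dual_prod (z, z') a - pairing a)"
      by (simp add: dual_prod_def blinfun.bilinear_simps algebra_simps)
    also have "\<dots> \<le> p * r + q * s"
      using y[OF a] z[OF a] pq by (intro add_mono mult_left_mono)
    finally show ?thesis
      using pq by simp
  qed
  then show "p *\<^sub>R y + q *\<^sub>R z \<in> fitzpatrick_domain M"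
    unfolding fitzpatrick_domain_def by blast
qed

lemma dom_op_subset_fitzpatrick_domain:
  assumes "monotone_op M"
  shows "dom_op M \<subseteq> fitzpatrick_domain M"
  using monotone_dual_prod_le[OF assms] unfolding subset_iff mem_dom_op_iff fitzpatrick_domain_def
  by blast

text \<open>The duality lemma with zero operator and zero functional: the required lower bound is
  that the Fitzpatrick function majorizes the pairing, and interiority makes every direction
  admissible.\<close>

lemma interior_fitzpatrick_domain_subset:
  fixes M :: "('b::banach, 'b dual) operator"
  assumes M: "maximal_monotone M"
  shows "interior (fitzpatrick_domain M) \<subseteq> dom_op M"
proof
  fix y0 assume "y0 \<in> interior (fitzpatrick_domain M)"
  then obtain d where d: "d > 0" "ball y0 d \<subseteq> fitzpatrick_domain M"
    by (auto simp: mem_interior)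
  obtain v where "(y0, v) \<in> M"
  proof (rule maximal_monotone_dual_point[OF M closed_UNIV subspace_UNIV])
    show "y' y0 + (0 :: 'b dual) x \<le> r"
      if "\<And>a. a \<in> M \<Longrightarrow> dual_prod (y0 + (0 :: 'b \<Rightarrow>\<^sub>L 'b) x, y') a - pairing a \<le> r" for x y' r
      using maximal_monotone_fitzpatrick_ge[OF M, of "(y0, y')" r] that by simp
    show "\<exists>t>0. \<exists>x y' r. \<forall>a\<in>M. dual_prod (y0 + (0 :: 'b \<Rightarrow>\<^sub>L 'b) x + t *\<^sub>R e, y') a - pairing a \<le> r"
      for e
    proof -
      define t where "t = d / (norm e + 1)"
      have t: "t > 0"
        using d(1) by (simp add: t_def add_nonneg_pos)
      have "t * norm e < d"
        using d(1) by (simp add: t_def field_simps add_pos_nonneg)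
      then have "y0 + t *\<^sub>R e \<in> fitzpatrick_domain M"
        using d(2) t by (auto simp: dist_norm)
      then show ?thesis
        using t by (auto simp: fitzpatrick_domain_def)
    qed
  qed auto
  then show "y0 \<in> dom_op M"
    by (auto simp: mem_dom_op_iff)
qed

theorem theorem5p9:
  fixes L :: "'a::banach \<Rightarrow>\<^sub>L 'b::banach"
    and M :: "('b, 'b dual) operator"
    and T :: "('a, 'a dual) operator"
  assumes "maximal_monotone M"
    and "T = pullback_op L M"
  shows "(dom_op T \<noteq> {} \<and> closed (dom_op T) \<and> convex (dom_op T)
           \<and> normal_cone (dom_op T) = pullback_op L (normal_cone (dom_op M))
           \<longrightarrow> NI_type T)
       \<and> (closed (dom_op M) \<and> convex (dom_op M)
           \<and> 0 \<in> ic_interior (set_diff_alg (range (blinfun_apply L)) (dom_op M))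
           \<longrightarrow> maximal_monotone T)
       \<and> (closed (dom_op T)
           \<and> range (blinfun_apply L) \<inter> interior (dom_op M) \<noteq> {}
           \<longrightarrow> maximal_monotone T)"
proof (intro conjI impI; elim conjE)
  assume dom: "dom_op T \<noteq> {}" "closed (dom_op T)" "convex (dom_op T)"
    and N: "normal_cone (dom_op T) = pullback_op L (normal_cone (dom_op M))"
  have add: "(x, x' + n) \<in> T" if "(x, x') \<in> T" "(x, n) \<in> normal_cone (dom_op T)" for x x' n
    using pullback_add_normal[OF assms(1)] N that unfolding assms(2) by blast
  show "NI_type T"
  proof (rule NI_typeI)
    show "T \<noteq> {}"
      using dom(1) by (auto simp: mem_dom_op_iff)
    show "pairing z \<le> c" if "\<And>a. a \<in> T \<Longrightarrow> dual_prod z a - pairing a \<le> c" for z c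
      using fitzpatrick_ge_of_normal[OF dom(2,3,1) add that] .
  qed
next
  assume "closed (dom_op M)" "convex (dom_op M)"
    and "0 \<in> ic_interior (set_diff_alg (range L) (dom_op M))"
  then show "maximal_monotone T"
    unfolding assms(2) using maximal_monotone_pullback_op[OF assms(1)] by blast
next
  assume closed: "closed (dom_op T)" and "range L \<inter> interior (dom_op M) \<noteq> {}"
  then obtain x1 where x1: "L x1 \<in> interior (dom_op M)"
    by blast
  let ?P = "fitzpatrick_domain M"
  have dom_P: "dom_op M \<subseteq> ?P"
    using assms(1) by (simp add: maximal_monotone_def dom_op_subset_fitzpatrick_domain)
  then have x1': "L x1 \<in> interior ?P"
    using x1 interior_mono by blast
  have "L u \<in> dom_op M" if u: "L u \<in> closure ?P" for u
  proof -
    \<comment> \<open>Moving \<open>u\<close> towards \<open>x1\<close> sends \<open>L (s n)\<close>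
      into the interior of \<open>?P\<close>, hence into D(M); closedness of D(T) recovers
      \<open>u\<close>. \<open>Suc n\<close> keeps the weight of \<open>x1\<close> in (0,
      1].\<close>
    define s where "s n = (1 - 1 / real (Suc n)) *\<^sub>R u + (1 / real (Suc n)) *\<^sub>R x1" for n
    have "s n \<in> dom_op T" for n
    proof -
      have "L (s n) \<in> interior ?P"
        using in_interior_closure_convex_shrink[OF convex_fitzpatrick_domain x1' u, of "1 / real (Suc n)"]
        by (simp add: s_def blinfun.bilinear_simps)
      then show ?thesis
        using interior_fitzpatrick_domain_subset[OF assms(1)]
        by (auto simp: assms(2) mem_dom_pullback_iff)
    qed
    moreover have "s \<longlonglongrightarrow> (1 - 0) *\<^sub>R u + 0 *\<^sub>R x1"
      unfolding s_def using LIMSEQ_Suc[OF lim_1_over_n] by (intro tendsto_intros)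
    ultimately have "u \<in> dom_op T"
      using closed_sequentially[OF closed, of s] by simp
    then show ?thesis
      by (simp add: assms(2) mem_dom_pullback_iff)
  qed
  moreover have "0 \<in> ic_interior (set_diff_alg (range L) (dom_op M))"
  proof (rule zero_in_ic_interior)
    obtain d where d: "d > 0" "ball (L x1) d \<subseteq> dom_op M"
      using x1 by (auto simp: mem_interior)
    have "ball 0 d \<subseteq> set_diff_alg (range L) (dom_op M)"
    proof
      fix w :: 'b assume "w \<in> ball 0 d"
      then have "L x1 - w \<in> dom_op M"
        using d(2) by (auto simp: dist_norm)
      moreover have "w = L x1 - (L x1 - w)"
        by simp
      ultimately show "w \<in> set_diff_alg (range L) (dom_op M)"
        unfolding set_diff_alg_def by blast
    qed
    then show "0 \<in> interior (set_diff_alg (range L) (dom_op M))"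
      using d(1) by (auto simp: mem_interior)
  qed
  moreover have "dom_op M \<subseteq> closure ?P"
    using dom_P closure_subset by blast
  ultimately show "maximal_monotone T"
    unfolding assms(2)
    by (intro maximal_monotone_pullback_op[OF assms(1), of "closure ?P"] closed_closure
        convex_closure convex_fitzpatrick_domain)
qed

end
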